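(* Let $m,n\ge0$ be integers. The shadow map $\mathrm{Sh}$ is a surjective meet semilattice morphism from the binary $m$-painted $n$-tree rotation lattice to the unary $m$-lighted $n$-shade rotation lattice; that is, it is surjective and $\mathrm{Sh}(\mathbb{T}\wedge\mathbb{T}')=\mathrm{Sh}(\mathbb{T})\wedge\mathrm{Sh}(\mathbb{T}')$ for all binary $m$-painted $n$-trees $\mathbb{T},\mathbb{T}'$.
   Context: Write $[k]=\{1,\dots,k\}$. **Painted trees.** An $n$-tree is a rooted plane tree with $n+1$ leaves, drawn growing downward from its root; "node" means internal node (leaves excluded), and unary nodes are allowed. A cut of an $n$-tree $T$ is a set of nodes of $T$ containing exactly one node on the path from the root to each leaf. A cut $c$ is below a cut $c'$ if, along any path from the root to a leaf, the node of $c$ is (strictly) after the node of $c'$. An $m$-painted $n$-tree $\mathbb{T}=(T,C,\mu)$ is an $n$-tree $T$ with a sequence $C=(c_1,\dots,c_k)$ of cuts of $T$, with $c_i$ below $c_{i+1}$ for all $i\in[k-1]$, such that $\bigcup C=c_1\cup\dots\cup c_k$ contains all unary nodes of $T$, and an ordered partition $\mu=(\mu_1,\dots,\mu_k)$ of $[m]$ into $k$ nonempty parts ($1\le k\le m$, or $k=0$ if $m=0$); $\mu_i$ is the label of $c_i$. It is binary if $k=m$, all nodes in $\bigcup C$ are unary and all nodes not in $\bigcup C$ are binary (have exactly two children). **Rotation lattice on painted trees.** The right rotation digraph on binary $m$-painted $n$-trees has three types of edges: (i) right rotate an edge of $T$ joining two binary nodes (a left child $i$ of $j$ is replaced by $j$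 becoming the right child of $i$, as in the Tamari lattice); (ii) move a cut past a binary node just above it (a binary node whose two children are both nodes of the same cut $c$ is replaced by a unary node of $c$ whose child is this binary node, whose two subtrees are now the former subtrees under the two unary nodes); (iii) exchange the labels of two consecutive cuts with no node of $T$ in between them, passing the small label above the large label (before the move the larger label is above the smaller one). It is known that this digraph is the Hasse diagram of a lattice (edges go upward in the order), the binary $m$-painted $n$-tree rotation lattice. **Shades.** An $m$-lighted $n$-shade is a pair of sequences $S=(s_1,\dots,s_\ell)$ and $(c_1,\dots,c_\ell)$ of the same length $\ell\ge 0$, where each $s_i$ is a (possibly empty) tuple of positive integers, the sum of all entries is $n$, the $c_i$ are pairwise disjoint (possibly empty) subsets of $[m]$ with union $[m]$, and $c_i\neq\varnothing$ whenever $s_i$ is empty. It is read from top to bottom; an index $i$ with $c_i\neq\varnothing$ is a cut with labels $c_i$. It is unary if for each $i$, either $s_i$ is empty and $c_i$ is a singleton, or $c_i=\varnothing$ and $s_i$ has exactly one entry (a "singleton tuple"). **Rotation lattice on shades.** The right rotation digraph on unary $m$-lighted $n$-shades has an edge from $\mathbb{S}$ to $\mathbb{S}'$ whenever $\mathbb{S}'$ is obtained from $\mathbb{S}$ by: (i) replacing a singleton tuple $(r)$ by two consecutive singleton tuples $(s),(t)$ with $r=s+t$, $s,t\ge1$; (ii) exchanging a singleton tuple with a cut immediately below it (the cut moves above it); or (iii) exchanging the labels of two consecutive cuts with no singleton tuple in between, passing the small label above the large label. This digraph is the Hasse diagram of a lattice (edges go upward), the unary $m$-lighted $n$-shade rotation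 lattice. **Shadow map.** The right branch of $T$ is the path from the root to the rightmost leaf. The shadow $\mathrm{Sh}(\mathbb{T})$ of $\mathbb{T}=(T,C,\mu)$ is the $m$-lighted $n$-shade whose $i$-th tuple is $(n_1,\dots,n_{p-1})$, where $n_1,\dots,n_p$ are the numbers of leaves of the subtrees, from left to right, of the $i$-th node of the right branch (from the root downward), and whose $i$-th label set is the label of the cut of $C$ containing this node ($\varnothing$ if there is none). *)

theory Defs
  imports "HOL-Algebra.Lattice" "HOL-Library.Sublist"
begin

section \<open>Plane trees\<close>

text \<open>
  Rooted plane trees whose nodes carry a decoration; undecorated trees are of type
  \<^typ>\<open>unit\<close> \<open>tree\<close>. The constructor \<open>Node\<close> builds the internal nodes, called nodes.
  Nodes and leaves are referred to by their addresses, that is, by the list of child positions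
  (counted from 0) leading to them from the root.
\<close>

datatype 'a tree = Leaf | Node 'a "'a tree list"

type_synonym address = "nat list"

fun subtree_at :: "'a tree \<Rightarrow> address \<Rightarrow> 'a tree option" where
  "subtree_at t [] = Some t"
| "subtree_at Leaf (i # p) = None"
| "subtree_at (Node x ts) (i # p) = (if i < length ts then subtree_at (ts ! i) p else None)"

definition nodes :: "'a tree \<Rightarrow> address set" where
  "nodes t = {p. \<exists>x ts. subtree_at t p = Some (Node x ts)}"

definition leaf_addresses :: "'a tree \<Rightarrow> address set" where
  "leaf_addresses t = {p. subtree_at t p = Some Leaf}"

definition children :: "'a tree \<Rightarrow> address \<Rightarrow> 'a tree list" where
  "children t p = (case subtree_at t p of Some (Node x ts) \<Rightarrow> ts | _ \<Rightarrow> [])"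

definition arity :: "'a tree \<Rightarrow> address \<Rightarrow> nat" where
  "arity t p = length (children t p)"

fun leaves :: "'a tree \<Rightarrow> nat" where
  "leaves Leaf = 1"
| "leaves (Node x ts) = sum_list (map leaves ts)"

definition n_tree :: "nat \<Rightarrow> unit tree \<Rightarrow> bool" where
  "n_tree n T \<longleftrightarrow> (\<forall>p\<in>nodes T. arity T p \<ge> 1) \<and> leaves T = n + 1"

section \<open>Painted trees\<close>

text \<open>An address lies on the path from the root to \<open>q\<close> iff it is a prefix of \<open>q\<close>.\<close>

definition is_cut :: "'a tree \<Rightarrow> address set \<Rightarrow> bool" where
  "is_cut T c \<longleftrightarrow>
     c \<subseteq> nodes T \<and> (\<forall>q\<in>leaf_addresses T. \<exists>!p. p \<in> c \<and> prefix p q)"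

definition below :: "'a tree \<Rightarrow> address set \<Rightarrow> address set \<Rightarrow> bool" where
  "below T c c' \<longleftrightarrow>
     (\<forall>q\<in>leaf_addresses T. \<forall>p\<in>c. \<forall>p'\<in>c'. prefix p q \<and> prefix p' q \<longrightarrow> strict_prefix p' p)"

definition ordered_partition :: "nat \<Rightarrow> nat set list \<Rightarrow> bool" where
  "ordered_partition m \<mu> \<longleftrightarrow>
     (\<forall>A\<in>set \<mu>. A \<noteq> {}) \<and> \<Union> (set \<mu>) = {1..m} \<and>
     (\<forall>i<length \<mu>. \<forall>j<length \<mu>. i \<noteq> j \<longrightarrow> \<mu> ! i \<inter> \<mu> ! j = {})"

text \<open>
  A triple \<open>(T, C, \<mu>)\<close>. The cuts are listed from the lowest one to the highest one, and
  indices start from 0.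
\<close>

type_synonym painted = "unit tree \<times> address set list \<times> nat set list"

definition painted_tree :: "nat \<Rightarrow> nat \<Rightarrow> painted \<Rightarrow> bool" where
  "painted_tree m n = (\<lambda>(T, C, \<mu>).
     n_tree n T \<and>
     (\<forall>c\<in>set C. is_cut T c) \<and>
     (\<forall>i. Suc i < length C \<longrightarrow> below T (C ! i) (C ! Suc i)) \<and>
     {p \<in> nodes T. arity T p = 1} \<subseteq> \<Union> (set C) \<and>
     length \<mu> = length C \<and> ordered_partition m \<mu>)"

definition binary_painted_tree :: "nat \<Rightarrow> nat \<Rightarrow> painted \<Rightarrow> bool" where
  "binary_painted_tree m n = (\<lambda>(T, C, \<mu>).
     painted_tree m n (T, C, \<mu>) \<and> length C = m \<and>
     (\<forall>p\<in>\<Union> (set C). arity T p = 1) \<and>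
     (\<forall>p\<in>nodes T - \<Union> (set C). arity T p = 2))"

section \<open>The rotation lattice on binary painted trees\<close>

definition cut_indices :: "address set list \<Rightarrow> address \<Rightarrow> nat set" where
  "cut_indices C p = {i. i < length C \<and> p \<in> C ! i}"

text \<open>
  To rewrite a tree together with its cuts, each node is decorated with the set of indices of the
  cuts containing it: \<open>depicts D T C\<close> holds iff \<open>D\<close> is the tree \<open>T\<close> decorated in this way. The
  decoration is empty outside the cuts and, since the cuts of a painted tree are disjoint, a
  singleton on them.
\<close>

definition depicts :: "nat set tree \<Rightarrow> unit tree \<Rightarrow> address set list \<Rightarrow> bool" where
  "depicts D T C \<longleftrightarrow>
     map_tree (\<lambda>_. ()) D = T \<and>
     (\<forall>p x ts. subtree_at D p = Some (Node x ts) \<longrightarrow> x = cut_indices C p)"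

inductive local_rotation :: "nat set tree \<Rightarrow> nat set tree \<Rightarrow> bool" where
  rotate_edge:
    "local_rotation (Node {} [Node {} [a, b], c]) (Node {} [a, Node {} [b, c]])"
| raise_cut:
    "local_rotation (Node {} [Node {i} [a], Node {i} [b]]) (Node {i} [Node {} [a, b]])"
| in_context:
    "local_rotation t t' \<Longrightarrow> local_rotation (Node x (us @ t # vs)) (Node x (us @ t' # vs))"

text \<open>
  In \<open>label_exchange\<close>, the cut with index \<open>Suc i\<close> is the upper one of the two consecutive cuts.
\<close>

definition label_exchange :: "painted \<Rightarrow> painted \<Rightarrow> bool" where
  "label_exchange = (\<lambda>(T, C, \<mu>) (T', C', \<mu>').
     T' = T \<and> C' = C \<and>
     (\<exists>i a b. Suc i < length C \<and> a < b \<and> \<mu> ! i = {a} \<and> \<mu> ! Suc i = {b} \<and>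
        \<not> (\<exists>p\<in>nodes T. \<exists>q\<in>C ! Suc i. \<exists>r\<in>C ! i. strict_prefix q p \<and> strict_prefix p r) \<and>
        \<mu>' = \<mu>[i := {b}, Suc i := {a}]))"

definition painted_rotation :: "nat \<Rightarrow> nat \<Rightarrow> painted \<Rightarrow> painted \<Rightarrow> bool" where
  "painted_rotation m n = (\<lambda>(T, C, \<mu>) (T', C', \<mu>').
     binary_painted_tree m n (T, C, \<mu>) \<and> binary_painted_tree m n (T', C', \<mu>') \<and>
     ((\<exists>D D'. depicts D T C \<and> depicts D' T' C' \<and> local_rotation D D' \<and> \<mu>' = \<mu>) \<or>
      label_exchange (T, C, \<mu>) (T', C', \<mu>')))"

definition painted_tree_lattice :: "nat \<Rightarrow> nat \<Rightarrow> painted gorder" where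
  "painted_tree_lattice m n =
     \<lparr>carrier = Collect (binary_painted_tree m n), eq = (=),
      le = (painted_rotation m n)\<^sup>*\<^sup>*\<rparr>"

section \<open>Lighted shades\<close>

text \<open>
  A pair of sequences of the same length is represented by the list of pairs
  \<open>(s\<^sub>i, c\<^sub>i)\<close>, read from top to bottom.
\<close>

type_synonym shade = "(nat list \<times> nat set) list"

definition lighted_shade :: "nat \<Rightarrow> nat \<Rightarrow> shade \<Rightarrow> bool" where
  "lighted_shade m n S \<longleftrightarrow>
     (\<forall>(s, c)\<in>set S. (\<forall>r\<in>set s. r > 0) \<and> (s = [] \<longrightarrow> c \<noteq> {})) \<and>
     sum_list (map (\<lambda>(s, c). sum_list s) S) = n \<and>
     (\<Union>(s, c)\<in>set S. c) = {1..m} \<and>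
     (\<forall>i<length S. \<forall>j<length S. i \<noteq> j \<longrightarrow> snd (S ! i) \<inter> snd (S ! j) = {})"

definition unary_shade :: "nat \<Rightarrow> nat \<Rightarrow> shade \<Rightarrow> bool" where
  "unary_shade m n S \<longleftrightarrow>
     lighted_shade m n S \<and>
     (\<forall>(s, c)\<in>set S. (s = [] \<and> (\<exists>a. c = {a})) \<or> (c = {} \<and> (\<exists>r. s = [r])))"

inductive shade_move :: "shade \<Rightarrow> shade \<Rightarrow> bool" where
  split_tuple:
    "s \<ge> 1 \<Longrightarrow> t \<ge> 1 \<Longrightarrow>
     shade_move (X @ ([s + t], {}) # Y) (X @ ([s], {}) # ([t], {}) # Y)"
| raise_cut:
    "shade_move (X @ ([r], {}) # ([], {a}) # Y) (X @ ([], {a}) # ([r], {}) # Y)"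
| exchange_labels:
    "a < b \<Longrightarrow>
     shade_move (X @ ([], {b}) # ([], {a}) # Y) (X @ ([], {a}) # ([], {b}) # Y)"

definition shade_rotation :: "nat \<Rightarrow> nat \<Rightarrow> shade \<Rightarrow> shade \<Rightarrow> bool" where
  "shade_rotation m n S S' \<longleftrightarrow> unary_shade m n S \<and> unary_shade m n S' \<and> shade_move S S'"

definition shade_lattice :: "nat \<Rightarrow> nat \<Rightarrow> shade gorder" where
  "shade_lattice m n =
     \<lparr>carrier = Collect (unary_shade m n), eq = (=), le = (shade_rotation m n)\<^sup>*\<^sup>*\<rparr>"

section \<open>The shadow map\<close>

text \<open>The addresses of the nodes on the right branch, from the root downward.\<close>

function right_branch :: "'a tree \<Rightarrow> address list" where
  "right_branch Leaf = []"
| "right_branch (Node x ts) =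
     [] # (if ts = [] then [] else map ((#) (length ts - 1)) (right_branch (last ts)))"
  by pat_completeness auto
termination
proof (relation "measure size")
  fix x :: 'a and ts :: "'a tree list"
  assume "ts \<noteq> []"
  then have "last ts \<in> set ts" by simp
  then have "size (last ts) < size_list size ts" 
    by (induction ts) auto
  then show "(last ts, Node x ts) \<in> measure size" by simp
qed simp

definition shadow :: "painted \<Rightarrow> shade" where
  "shadow = (\<lambda>(T, C, \<mu>).
     map (\<lambda>p. (map leaves (butlast (children T p)), \<Union>i\<in>cut_indices C p. \<mu> ! i))
       (right_branch T))"

end

(*
  A binary painted tree is a binary tree cut by unary nodes, together with the word w of the labels
  of its cuts, read downward. Number its binary nodes 1, ..., n in inorder. The order is containment
  of the following data: the pairs of labels a < b such that a is above b, the set of labels above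
  each node, and the size of the right subtree of each node. Conversely, whenever the data of a tree
  are dominated by abstract data subject to the obvious compatibility conditions, either they
  are equal or the tree has a rotation that is still dominated. Hence every compatible
  data come from a unique tree, and meets exist because the data of two trees have a largest
  compatible lower bound; as for the weak order, it is obtained by transitively closing the
  union of the noninversions.

  The shadow map preserves meets because it has a left adjoint: a shade S is sent to the least tree
  with shadow S, where left combs with all their cuts at the bottom hang off the right branch.
  This adjoint is a section of the shadow map, which is therefore surjective.
*)

theory Submission
  imports Defs
begin

section \<open>Binary trees with cuts\<close>

text \<open>Every path from the root to a leaf crosses the same cuts in the same order, so a cut is
  known from the number of cuts beneath it. Hence the labels can live in a word apart from the tree,
  on which only the condition of uniform depth remains.

  Meets cannot be formed componentwise, because the three kinds of data constrain each other. A
  componentwise minimum of bracket vectors turns more nodes into left descendants; a label that must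
  stay below such a descendant must then also stay below its new ancestors, and it drags along the
  labels beneath it. Data corrected in this way belong to no visible tree, which is why the
  conditions on abstract data are isolated and then realised by climbing from the least tree, one
  rotation at a time.

  The shades get no such analysis: the adjunction turns lower bounds of two shadows into lower
  bounds of two trees.\<close>

datatype cut_tree = Tip | Cut cut_tree | Fork cut_tree cut_tree

fun forks :: "cut_tree \<Rightarrow> nat" where
  "forks Tip = 0"
| "forks (Cut t) = forks t"
| "forks (Fork l r) = Suc (forks l + forks r)"

fun depth :: "cut_tree \<Rightarrow> nat" where
  "depth Tip = 0"
| "depth (Cut t) = Suc (depth t)"
| "depth (Fork l r) = depth l"

fun uniform :: "cut_tree \<Rightarrow> bool" where
  "uniform Tip \<longleftrightarrow> True"
| "uniform (Cut t) \<longleftrightarrow> uniform t"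
| "uniform (Fork l r) \<longleftrightarrow> uniform l \<and> uniform r \<and> depth l = depth r"

text \<open>
  The binary nodes are numbered in inorder from 0, so the subtree of node \<open>i\<close> extends to the right
  as far as node \<open>i + reach t i\<close>; \<open>reach\<close> is a bracket vector. Values at \<open>i \<ge> forks t\<close> are junk.
\<close>

fun reach :: "cut_tree \<Rightarrow> nat \<Rightarrow> nat" where
  "reach Tip i = 0"
| "reach (Cut t) i = reach t i"
| "reach (Fork l r) i =
     (if i < forks l then reach l i else if i = forks l then forks r
      else reach r (i - Suc (forks l)))"

fun cuts_under :: "cut_tree \<Rightarrow> nat \<Rightarrow> nat" where
  "cuts_under Tip i = 0"
| "cuts_under (Cut t) i = cuts_under t i"
| "cuts_under (Fork l r) i =
     (if i < forks l then cuts_under l i else if i = forks l then depth l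
      else cuts_under r (i - Suc (forks l)))"

inductive rot :: "cut_tree \<Rightarrow> cut_tree \<Rightarrow> bool" where
  rot_edge: "rot (Fork (Fork a b) c) (Fork a (Fork b c))"
| rot_raise: "rot (Fork (Cut a) (Cut b)) (Cut (Fork a b))"
| rot_Cut: "rot t t' \<Longrightarrow> rot (Cut t) (Cut t')"
| rot_left: "rot t t' \<Longrightarrow> rot (Fork t u) (Fork t' u)"
| rot_right: "rot t t' \<Longrightarrow> rot (Fork u t) (Fork u t')"

lemma rot_forks: "rot t t' \<Longrightarrow> forks t' = forks t"
  by (induction rule: rot.induct) auto

lemma rot_depth: "rot t t' \<Longrightarrow> depth t' = depth t"
  by (induction rule: rot.induct) auto

lemma rot_uniform: "rot t t' \<Longrightarrow> uniform t \<Longrightarrow> uniform t'"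
  by (induction rule: rot.induct) (auto simp: rot_depth)

lemma fork_cases:
  assumes "i < forks (Fork l r)"
  obtains "i < forks l" | "i = forks l" | k where "i = Suc (forks l + k)" "k < forks r"
proof -
  consider "i < forks l" | "i = forks l" | "i > forks l" by linarith
  then show ?thesis
  proof cases
    case 3
    then have "i = Suc (forks l + (i - Suc (forks l)))" by simp
    then show ?thesis using that(3) assms by fastforce
  qed (use that in auto)
qed

lemma right_forkE:
  assumes "forks l < j" "j < forks (Fork l r)"
  obtains k where "j = Suc (forks l + k)" "k < forks r"
  using assms(2,1) by (cases rule: fork_cases) auto

lemma reach_bound: "i < forks t \<Longrightarrow> i + reach t i < forks t"
proof (induction t arbitrary: i)
  case (Fork l r)
  from Fork.prems show ?case
    by (cases rule: fork_cases) (use Fork.IH in fastforce)+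
qed auto

lemma cuts_under_le: "uniform t \<Longrightarrow> i < forks t \<Longrightarrow> cuts_under t i \<le> depth t"
proof (induction t arbitrary: i)
  case (Fork l r)
  from Fork.prems(2) show ?case
    by (cases rule: fork_cases) (use Fork in auto)
next
  case (Cut t)
  then show ?case using Cut.IH[of i] by (simp add: le_SucI)
qed auto

text \<open>Rotations keep the inorder of the binary nodes, so the data can be compared node by
  node. An edge rotation changes the data only by enlarging one \<open>reach\<close>, raising a cut
  only by lowering one \<open>cuts_under\<close>. Uniformity enters for the old upper node of a
  rotated edge, whose \<open>cuts_under\<close> goes from \<open>depth (Fork a b)\<close> to
  \<open>depth b\<close>.\<close>

lemma rot_mono:
  assumes "rot t t'" "uniform t" "i < forks t"
  shows "reach t i \<le> reach t' i \<and> cuts_under t' i \<le> cuts_under t i"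
  using assms
proof (induction arbitrary: i rule: rot.induct)
  case (rot_edge a b c)
  have edge: ?case if "i < forks (Fork a b)"
    using that by (cases rule: fork_cases) auto
  from rot_edge.prems(2) show ?case
  proof (cases rule: fork_cases)
    case 1
    then show ?thesis by (rule edge)
  next
    case 2
    then show ?thesis using rot_edge.prems(1) by simp
  next
    case (3 k)
    then show ?thesis by simp
  qed
next
  case (rot_left t t' u)
  from rot_left.prems(2) show ?case
    by (cases rule: fork_cases) (use rot_left in \<open>auto simp: rot_forks rot_depth\<close>)
next
  case (rot_right t t' u)
  from rot_right.prems(2) show ?case
    by (cases rule: fork_cases) (use rot_right in \<open>auto simp: rot_forks rot_depth\<close>)
qed auto

section \<open>Bracket vectors and the heights compatible with them\<close>

definition bracket :: "nat \<Rightarrow> (nat \<Rightarrow> nat) \<Rightarrow> bool" where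
  "bracket n r \<longleftrightarrow> (\<forall>i<n. i + r i < n) \<and> (\<forall>i j. i < j \<and> j \<le> i + r i \<and> j < n \<longrightarrow> j + r j \<le> i + r i)"

text \<open>Node \<open>i\<close> is \<open>j\<close> or lies in the left subtree of \<open>j\<close>.\<close>

definition lies_left :: "(nat \<Rightarrow> nat) \<Rightarrow> nat \<Rightarrow> nat \<Rightarrow> bool" where
  "lies_left r i j \<longleftrightarrow> i \<le> j \<and> (\<forall>k. i \<le> k \<and> k < j \<longrightarrow> k + r k < j)"

text \<open>\<open>P i j\<close> holds whenever \<open>i\<close> is a weak descendant of \<open>j\<close>.\<close>

definition compat :: "nat \<Rightarrow> (nat \<Rightarrow> nat) \<Rightarrow> (nat \<Rightarrow> nat \<Rightarrow> bool) \<Rightarrow> bool" where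
  "compat n r P \<longleftrightarrow> 
    (\<forall>i j. i < j \<and> j \<le> i + r i \<and> j < n \<longrightarrow> P j i) \<and>
    (\<forall>i j. lies_left r i j \<and> j < n \<longrightarrow> P i j)"

text \<open>Bracket vectors are the classical coordinates of the Tamari lattice. The interval of the
  root of a \<open>Fork\<close> ends at the last node, and no interval from the left subtree gets as
  far as that root.\<close>

lemma bracket_reach: "bracket (forks t) (reach t)"
proof -
  have "i < j \<Longrightarrow> j \<le> i + reach t i \<Longrightarrow> j < forks t \<Longrightarrow> j + reach t j \<le> i + reach t i" for i j
  proof (induction t arbitrary: i j)
    case (Fork l r)
    from Fork.prems have "i < forks (Fork l r)" by simp
    then show ?case
    proof (cases rule: fork_cases)
      case 1
      then have "j < forks l" using Fork.prems reach_bound[of i l] by simp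
      then show ?thesis using 1 Fork.IH(1)[of i j] Fork.prems by simp
    next
      case 2
      then obtain k where "j = Suc (forks l + k)" "k < forks r"
        using Fork.prems right_forkE[of l j r] by auto
      then show ?thesis using 2 reach_bound[of k r] by simp
    next
      case (3 h)
      then obtain k where "j = Suc (forks l + k)" "k < forks r"
        using Fork.prems right_forkE[of l j r] by auto
      then show ?thesis using 3 Fork.IH(2)[of h k] Fork.prems by simp
    qed
  qed auto
  then show ?thesis using reach_bound by (auto simp: bracket_def)
qed

lemma lies_left_refl: "lies_left r i i"
  by (simp add: lies_left_def)

text \<open>The cuts between a descendant and its ancestor are counted only for the ancestor. The
  two parts treat descendants on the right and on the left.\<close>

lemma compat_cuts_under:
  assumes "uniform t"
  shows "compat (forks t) (reach t) (\<lambda>i j. cuts_under t i \<le> cuts_under t j)"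
proof -
  have "i < j \<Longrightarrow> j \<le> i + reach t i \<Longrightarrow> j < forks t \<Longrightarrow> cuts_under t j \<le> cuts_under t i" for i j
    using assms
  proof (induction t arbitrary: i j)
    case (Fork l r)
    from Fork.prems have "i < forks (Fork l r)" by simp
    then show ?case
    proof (cases rule: fork_cases)
      case 1
      then have "j < forks l" using Fork.prems reach_bound[of i l] by simp
      then show ?thesis using 1 Fork.IH(1)[of i j] Fork.prems by simp
    next
      case 2
      then obtain k where "j = Suc (forks l + k)" "k < forks r"
        using Fork.prems right_forkE[of l j r] by auto
      then show ?thesis using 2 cuts_under_le[of r k] Fork.prems by simp
    next
      case (3 h)
      then obtain k where "j = Suc (forks l + k)" "k < forks r"
        using Fork.prems right_forkE[of l j r] by auto
      then show ?thesis using 3 Fork.IH(2)[of h k] Fork.prems by simp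
    qed
  qed auto
  moreover
  have "lies_left (reach t) i j \<Longrightarrow> j < forks t \<Longrightarrow> cuts_under t i \<le> cuts_under t j" for i j
    using assms
  proof (induction t arbitrary: i j)
    case (Fork l r)
    have ij: "i \<le> j" and between: "\<And>k. i \<le> k \<Longrightarrow> k < j \<Longrightarrow> k + reach (Fork l r) k < j"
      using Fork.prems by (auto simp: lies_left_def)
    \<comment> \<open>The interval of the root extends to the last node, so the root cannot occur
      from \<open>i\<close> on strictly before \<open>j\<close>: either \<open>i\<close> and
      \<open>j\<close> lie in the same subtree, or \<open>j\<close> is the root itself.\<close>
    have root: "\<not> (i \<le> forks l \<and> forks l < j)" using between[of "forks l"] Fork.prems(2) by auto
    from Fork.prems(2) show ?case
    proof (cases rule: fork_cases)
      case 1
      then have "lies_left (reach l) i j" using ij between by (force simp: lies_left_def)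
      then show ?thesis using 1 Fork ij by simp
    next
      case 2
      then show ?thesis using Fork.prems cuts_under_le[of l i] ij by auto
    next
      case (3 k)
      then obtain h where h: "i = Suc (forks l + h)" using root ij
        by (metis add_Suc le_Suc_ex less_Suc_eq_le linorder_not_le less_iff_Suc_add)
      have "lies_left (reach r) h k"
        unfolding lies_left_def
      proof (intro conjI allI impI)
        fix x assume "h \<le> x \<and> x < k"
        then show "x + reach r x < k" using between[of "Suc (forks l + x)"] 3 h by simp
      qed (use 3 h ij in simp)
      then show ?thesis using 3 h Fork by simp
    qed
  qed (auto simp: lies_left_def)
  ultimately show ?thesis unfolding compat_def by blast
qed

text \<open>
  The subtree occupies the nodes \<open>s, \<dots>, s + forks t - 1\<close> of the target. The right branch has to be
  exempted in the second alternative: there the target may leave the subtree.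
\<close>

lemma rot_towards:
  assumes "bracket n r" and "compat n r (\<lambda>i j. e i \<le> e j)"
    and "uniform t" and "s + forks t \<le> n"
    and "\<forall>i<forks t. reach t i \<le> r (s + i) \<and> e (s + i) \<le> cuts_under t i"
  shows "(\<exists>t'. rot t t' \<and>
       (\<forall>i<forks t. reach t' i \<le> r (s + i) \<and> e (s + i) \<le> cuts_under t' i)) \<or>
     (\<forall>i<forks t. cuts_under t i = e (s + i) \<and>
       (reach t i = r (s + i) \<or> Suc (i + reach t i) = forks t))"
  using assms(3-)
proof (induction t arbitrary: s)
  case Tip
  then show ?case by simp
next
  case (Cut t)
  have "(\<exists>t'. rot t t' \<and> (\<forall>i<forks t. reach t' i \<le> r (s + i) \<and> e (s + i) \<le> cuts_under t' i)) \<or>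
     (\<forall>i<forks t. cuts_under t i = e (s + i) \<and>
       (reach t i = r (s + i) \<or> Suc (i + reach t i) = forks t))"
    by (rule Cut.IH[OF Cut.prems[unfolded forks.simps uniform.simps reach.simps cuts_under.simps]])
  then show ?case
  proof (elim disjE exE)
    fix t' assume "rot t t' \<and> (\<forall>i<forks t. reach t' i \<le> r (s + i) \<and> e (s + i) \<le> cuts_under t' i)"
    then show ?thesis by (intro disjI1 exI[of _ "Cut t'"]) (simp add: rot_Cut)
  next
    assume "\<forall>i<forks t. cuts_under t i = e (s + i) \<and>
       (reach t i = r (s + i) \<or> Suc (i + reach t i) = forks t)"
    then show ?thesis by (intro disjI2) simp
  qed
next
  case (Fork a b)
  define j where "j = s + forks a"
  define N where "N = (\<lambda>t'. \<forall>i<forks (Fork a b). reach t' i \<le> r (s + i) \<and> e (s + i) \<le> cuts_under t' i)"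
  have le: "reach (Fork a b) i \<le> r (s + i)" "e (s + i) \<le> cuts_under (Fork a b) i" 
    if "i < forks (Fork a b)" for i
    using Fork.prems(3) that by blast+
  have la: "\<forall>i<forks a. reach a i \<le> r (s + i) \<and> e (s + i) \<le> cuts_under a i"
  proof (intro allI impI)
    fix i assume "i < forks a"
    then show "reach a i \<le> r (s + i) \<and> e (s + i) \<le> cuts_under a i"
      using le[of i] by simp
  qed
  have lb: "\<forall>i<forks b. reach b i \<le> r (Suc j + i) \<and> e (Suc j + i) \<le> cuts_under b i"
  proof (intro allI impI)
    fix i assume "i < forks b"
    then show "reach b i \<le> r (Suc j + i) \<and> e (Suc j + i) \<le> cuts_under b i" 
      using le[of "Suc (forks a + i)"] by (simp add: j_def add.assoc)
  qed
  have lj: "forks b \<le> r j" "e j \<le> depth a" using le[of "forks a"] by (auto simp: j_def)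
  have jn: "j < n" "Suc j + forks b \<le> n" using Fork.prems by (auto simp: j_def)
  have u: "uniform a" "uniform b" "depth b = depth a" using Fork.prems by auto
  have desc: "e y \<le> e x" "y + r y \<le> x + r x" if "x < y" "y \<le> x + r x" "y < n" for x y
    using assms(1,2) that unfolding compat_def bracket_def by blast+
  have left: "e x \<le> e y" if "lies_left r x y" "y < n" for x y
    using assms(2) that unfolding compat_def by blast
  show ?case
  proof (cases "\<exists>t'. rot (Fork a b) t' \<and> N t'")
    case True
    then show ?thesis by (auto simp: N_def)
  next
    case False
    \<comment> \<open>From here on no single rotation stays dominated. The facts below show that
      such a stuck tree agrees with the target, because a deviation would leave room for a
      rotation.\<close>
    have no: "\<not> N t'" if "rot (Fork a b) t'" for t' using False that by blast
    have Za: "\<forall>i<forks a. cuts_under a i = e (s + i) \<and> 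
       (reach a i = r (s + i) \<or> Suc (i + reach a i) = forks a)"
    proof (rule ccontr)
      assume "\<not> ?thesis"
      then obtain a' where a': "rot a a'" 
        "\<forall>i<forks a. reach a' i \<le> r (s + i) \<and> e (s + i) \<le> cuts_under a' i"
        using Fork.IH(1)[of s] Fork.prems(2) u la by auto
      have "N (Fork a' b)"
        unfolding N_def
      proof (intro allI impI)
        fix i assume "i < forks (Fork a b)"
        then show "reach (Fork a' b) i \<le> r (s + i) \<and> e (s + i) \<le> cuts_under (Fork a' b) i"
          using a' le[of i] by (simp add: rot_forks[OF a'(1)] rot_depth[OF a'(1)] split: if_splits)
      qed
      then show False using no rot_left a'(1) by blast
    qed
    have Zb: "\<forall>i<forks b. cuts_under b i = e (Suc j + i) \<and> 
       (reach b i = r (Suc j + i) \<or> Suc (i + reach b i) = forks b)"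
    proof (rule ccontr)
      assume "\<not> ?thesis"
      then obtain b' where b': "rot b b'" 
        "\<forall>i<forks b. reach b' i \<le> r (Suc j + i) \<and> e (Suc j + i) \<le> cuts_under b' i"
        using Fork.IH(2)[of "Suc j"] jn u lb by auto
      have "N (Fork a b')"
        unfolding N_def
      proof (intro allI impI)
        fix i assume "i < forks (Fork a b)"
        then show "reach (Fork a b') i \<le> r (s + i) \<and> e (s + i) \<le> cuts_under (Fork a b') i"
          by (cases rule: fork_cases)
            (use b' le[of i] in \<open>auto simp: rot_forks[OF b'(1)] j_def add.assoc\<close>)
      qed
      then show False using no rot_right b'(1) by blast
    qed
    \<comment> \<open>If the target interval of the left child reached the root \<open>j\<close>,
      nesting would make it contain the whole interval of \<open>j\<close>, hence all of
      \<open>b\<close>, and rotating the edge would stay dominated.\<close>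
    have edge: "s + forks a1 + r (s + forks a1) < j" if a: "a = Fork a1 a2" for a1 a2
    proof (rule ccontr)
      assume "\<not> ?thesis"
      then have r1: "j + r j \<le> s + forks a1 + r (s + forks a1)"
        using desc(2)[of "s + forks a1" j] a jn by (simp add: j_def)
      have "N (Fork a1 (Fork a2 b))"
        unfolding N_def
      proof (intro allI impI)
        fix i assume i: "i < forks (Fork a b)"
        show "reach (Fork a1 (Fork a2 b)) i \<le> r (s + i) \<and>
          e (s + i) \<le> cuts_under (Fork a1 (Fork a2 b)) i"
        proof (cases "i = forks a1")
          case True
          then show ?thesis using r1 lj le[OF i] a by (auto simp: j_def)
        next
          case False
          then have "reach (Fork a1 (Fork a2 b)) i = reach (Fork a b) i"
              "cuts_under (Fork a1 (Fork a2 b)) i = cuts_under (Fork a b) i" 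
            using i a u(1) by (auto simp: not_less le_Suc_eq)
          then show ?thesis using le[OF i] by simp
        qed
      qed
      then show False using no rot_edge a by blast
    qed
    \<comment> \<open>A root height that is still too large forces a cut on top of both subtrees:
      the root of a binary subtree would be a descendant of \<open>j\<close> in the target with a
      larger \<open>e\<close>. The two cut nodes could then be raised.\<close>
    have ej: "e j = depth a"
    proof (rule ccontr)
      assume "e j \<noteq> depth a"
      then have ej: "e j < depth a" using lj by simp
      show False
      proof (cases a)
        case Tip
        then show ?thesis using ej by simp
      next
        case (Fork a1 a2)
        define c where "c = s + forks a1"
        have c: "c < j" "c + forks a2 < j" "j = Suc (c + forks a2)" using Fork by (auto simp: c_def j_def)
        have rc: "forks a2 \<le> r c" using la[rule_format, of "forks a1"] Fork by (simp add: c_def)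
        have "lies_left r c j"
          unfolding lies_left_def
        proof (intro conjI allI impI)
          fix k assume k: "c \<le> k \<and> k < j"
          then have "k + r k \<le> c + r c" using desc(2)[of c k] rc c jn by (cases "k = c") auto
          then show "k + r k < j" using edge[OF Fork] by (simp add: c_def)
        qed (use c in simp)
        then have "e c \<le> e j" using left jn by blast
        then show ?thesis using Za[rule_format, of "forks a1"] Fork ej by (simp add: c_def)
      next
        case a: (Cut a1)
        show ?thesis
        proof (cases b)
          case Tip
          then show ?thesis using ej u by simp
        next
          case (Fork b1 b2)
          then have "e (Suc j + forks b1) \<le> e j" using desc(1)[of j "Suc j + forks b1"] lj jn by simp
          then show ?thesis using Zb[rule_format, of "forks b1"] Fork ej u by simp
        next
          case (Cut b1)
          have "N (Cut (Fork a1 b1))"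
            unfolding N_def
          proof (intro allI impI)
            fix i assume i: "i < forks (Fork a b)"
            show "reach (Cut (Fork a1 b1)) i \<le> r (s + i) \<and>
              e (s + i) \<le> cuts_under (Cut (Fork a1 b1)) i"
              using le[OF i] ej a Cut by (auto simp: j_def split: if_splits)
          qed
          then show False using no rot_raise a Cut by blast
        qed
      qed
    qed
    \<comment> \<open>The exemption of the right branch ends for \<open>a\<close>: a node of it that
      reaches \<open>j\<close> in the target would have all the cuts of \<open>a\<close> beneath it,
      so \<open>a\<close> would be a \<open>Fork\<close> whose root also reaches \<open>j\<close>,
      against \<open>edge\<close>.\<close>
    have ra: "reach a i = r (s + i)" if i: "i < forks a" for i
    proof (rule ccontr)
      assume "reach a i \<noteq> r (s + i)"
      then have on: "Suc (i + reach a i) = forks a" "reach a i < r (s + i)" using Za la i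
        by (auto simp: le_less)
      then have sj: "j \<le> s + i + r (s + i)" by (simp add: j_def)
      then have "e j \<le> e (s + i)" using desc(1)[of "s + i" j] i jn by (simp add: j_def)
      then have cu: "depth a \<le> cuts_under a i" using ej Za i by simp
      show False
      proof (cases a)
        case Tip
        then show ?thesis using i by simp
      next
        case (Cut a1)
        then show ?thesis using cu cuts_under_le[of a1 i] i u by simp
      next
        case (Fork a1 a2)
        from i[unfolded Fork] show ?thesis
        proof (cases rule: fork_cases)
          case 1
          then show ?thesis using on(1) Fork reach_bound[of i a1] by simp
        next
          case 2
          then show ?thesis using edge[OF Fork] sj by simp
        next
          case (3 k)
          have "forks a2 \<le> r (s + forks a1)" using la[rule_format, of "forks a1"] Fork by simp
          then have "s + i + r (s + i) \<le> s + forks a1 + r (s + forks a1)" 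
            using desc(2)[of "s + forks a1" "s + i"] 3 i jn by (simp add: j_def)
          then show ?thesis using edge[OF Fork] sj by simp
        qed
      qed
    qed
    have "cuts_under (Fork a b) i = e (s + i) \<and>
       (reach (Fork a b) i = r (s + i) \<or> Suc (i + reach (Fork a b) i) = forks (Fork a b))" 
      if "i < forks (Fork a b)" for i
      using that
    proof (cases rule: fork_cases)
      case 1
      then show ?thesis using Za ra by simp
    next
      case 2
      then show ?thesis using ej by (simp add: j_def)
    next
      case (3 k)
      then show ?thesis using Zb[rule_format, of k] by (auto simp: j_def add.assoc)
    qed
    then show ?thesis by blast
  qed
qed

lemma rot_strict:
  assumes "rot t t'"
  shows "\<exists>i<forks t. reach t i < reach t' i \<or> cuts_under t' i < cuts_under t i"
  using assms
proof (induction rule: rot.induct)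
  case (rot_edge a b c)
  show ?case by (rule exI[of _ "forks a"]) simp
next
  case (rot_raise a b)
  show ?case by (rule exI[of _ "forks a"]) simp
next
  case (rot_left t t' u)
  then obtain i where "i < forks t" "reach t i < reach t' i \<or> cuts_under t' i < cuts_under t i"
    by blast
  then show ?case by (intro exI[of _ i]) (simp add: rot_forks[OF rot_left.hyps])
next
  case (rot_right t t' u)
  then obtain i where "i < forks t" "reach t i < reach t' i \<or> cuts_under t' i < cuts_under t i"
    by blast
  then show ?case by (intro exI[of _ "Suc (forks u + i)"]) simp
qed simp

text \<open>Dominated rotations decrease the summed distance, so they run out. For the whole tree
  the exempted right branch is harmless: a \<open>reach\<close> that ends at the last node is as
  large as a bracket vector on \<open>n\<close> nodes permits.\<close>

lemma rots_towards:
  assumes "bracket n r" and "compat n r (\<lambda>i j. e i \<le> e j)"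
    and "uniform t" and "forks t = n"
    and "\<forall>i<n. reach t i \<le> r i \<and> e i \<le> cuts_under t i"
  shows "\<exists>t'. rot\<^sup>*\<^sup>* t t' \<and> (\<forall>i<n. cuts_under t' i = e i \<and> reach t' i = r i)"
  using assms(3-)
proof (induction "\<Sum>i<n. (r i - reach t i) + (cuts_under t i - e i)" arbitrary: t rule: less_induct)
  case less
  show ?case
  proof (cases "\<exists>t'. rot t t' \<and> (\<forall>i<n. reach t' i \<le> r i \<and> e i \<le> cuts_under t' i)")
    case True
    then obtain t' where t': "rot t t'" "\<forall>i<n. reach t' i \<le> r i \<and> e i \<le> cuts_under t' i"
      by blast
    have mono: "reach t i \<le> reach t' i \<and> cuts_under t' i \<le> cuts_under t i" if "i < n" for i
      using rot_mono[OF t'(1)] less.prems that by simp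
    obtain j where j: "j < n" "reach t j < reach t' j \<or> cuts_under t' j < cuts_under t j"
      using rot_strict[OF t'(1)] less.prems by auto
    have "(\<Sum>i<n. (r i - reach t' i) + (cuts_under t' i - e i)) <
      (\<Sum>i<n. (r i - reach t i) + (cuts_under t i - e i))"
    proof (rule sum_strict_mono_ex1)
      show "\<forall>i\<in>{..<n}. r i - reach t' i + (cuts_under t' i - e i) \<le>
        r i - reach t i + (cuts_under t i - e i)"
        using mono by (simp add: add_mono diff_le_mono diff_le_mono2)
      have "reach t j \<le> reach t' j" "cuts_under t' j \<le> cuts_under t j"
        "reach t' j \<le> r j" "e j \<le> cuts_under t' j" using mono t'(2) j by auto
      then have "r j - reach t' j + (cuts_under t' j - e j) < r j - reach t j + (cuts_under t j - e j)"
        using j(2) by arith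
      then show "\<exists>i\<in>{..<n}. r i - reach t' i + (cuts_under t' i - e i) <
        r i - reach t i + (cuts_under t i - e i)" using j(1) by blast
    qed simp
    then obtain t'' where "rot\<^sup>*\<^sup>* t' t''" "\<forall>i<n. cuts_under t'' i = e i \<and> reach t'' i = r i"
      using less.hyps[of t'] less.prems t' rot_uniform rot_forks by blast
    then show ?thesis using t'(1) by (meson converse_rtranclp_into_rtranclp)
  next
    case False
    have "\<forall>i<n. cuts_under t i = e i \<and> (reach t i = r i \<or> Suc (i + reach t i) = n)"
      using rot_towards[OF assms(1,2) less.prems(1), of 0] less.prems False by simp
    moreover have "i + r i < n" if "i < n" for i using assms(1) that by (simp add: bracket_def)
    ultimately have "\<forall>i<n. cuts_under t i = e i \<and> reach t i = r i"
      using less.prems(3) by (metis add_le_cancel_left less_Suc_eq_le order_antisym)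
    then show ?thesis by blast
  qed
qed

text \<open>The root can be read off: a \<open>Cut\<close> on top makes every
  \<open>cuts_under\<close> smaller than the depth, while the root of a \<open>Fork\<close> attains
  it, and that root is the first node whose interval ends at the last node. The depth is compared
  separately because a tree without forks has no data.\<close>

lemma cut_tree_eqI:
  assumes "uniform t" "uniform t'" "depth t = depth t'" "forks t = forks t'"
    and "\<forall>i<forks t. reach t i = reach t' i \<and> cuts_under t i = cuts_under t' i"
  shows "t = t'"
  using assms
proof (induction t arbitrary: t')
  case Tip
  then show ?case by (cases t') auto
next
  case (Cut t)
  show ?case
  proof (cases t')
    case (Fork l r)
    then show ?thesis using Cut.prems cuts_under_le[of t "forks l"] by auto
  qed (use Cut in auto)
next
  case (Fork l r)
  show ?case
  proof (cases t')
    case Tip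
    then show ?thesis using Fork.prems by simp
  next
    case (Cut u)
    then show ?thesis using Fork.prems(1-4) Fork.prems(5)[rule_format, of "forks l"]
        cuts_under_le[of u "forks l"] by simp
  next
    case t': (Fork l' r')
    have reaches: "reach (Fork l r) i = reach (Fork l' r') i" 
      and cuts: "cuts_under (Fork l r) i = cuts_under (Fork l' r') i" if "i < forks (Fork l r)" for i
      using Fork.prems(5) t' that by blast+
    have sz: "forks l + forks r = forks l' + forks r'" using Fork.prems(4) t' by simp
    have "\<not> forks l < forks l'"
      using reaches[of "forks l"] sz reach_bound[of "forks l" l'] by auto
    moreover have "\<not> forks l' < forks l"
      using reaches[of "forks l'"] sz reach_bound[of "forks l'" l] by auto
    ultimately have fl: "forks l = forks l'" by simp
    have "l = l'"
    proof (rule Fork.IH(1))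
      show "\<forall>i<forks l. reach l i = reach l' i \<and> cuts_under l i = cuts_under l' i"
      proof (intro allI impI)
        fix i assume "i < forks l"
        then show "reach l i = reach l' i \<and> cuts_under l i = cuts_under l' i"
          using reaches[of i] cuts[of i] fl by simp
      qed
    qed (use Fork.prems t' fl in auto)
    moreover have "r = r'"
    proof (rule Fork.IH(2))
      show "\<forall>i<forks r. reach r i = reach r' i \<and> cuts_under r i = cuts_under r' i"
      proof (intro allI impI)
        fix i assume "i < forks r"
        then show "reach r i = reach r' i \<and> cuts_under r i = cuts_under r' i"
          using reaches[of "Suc (forks l + i)"] cuts[of "Suc (forks l + i)"] fl by simp
      qed
    qed (use Fork.prems t' fl in auto)
    ultimately show ?thesis using t' by simp
  qed
qed

section \<open>The order as containment of inversions\<close>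

fun precedes :: "'a list \<Rightarrow> 'a \<Rightarrow> 'a \<Rightarrow> bool" where
  "precedes [] x y \<longleftrightarrow> False"
| "precedes (a # w) x y \<longleftrightarrow> a = x \<and> y \<in> set w \<or> precedes w x y"

lemma precedes_in_set: "precedes w x y \<Longrightarrow> x \<in> set w \<and> y \<in> set w"
  by (induction w) auto

lemma precedes_append:
  "precedes (u @ v) x y \<longleftrightarrow> precedes u x y \<or> precedes v x y \<or> x \<in> set u \<and> y \<in> set v"
  by (induction u) auto

lemma precedes_asym: "distinct w \<Longrightarrow> precedes w x y \<Longrightarrow> \<not> precedes w y x"
  by (induction w) (auto dest: precedes_in_set)

lemma precedes_total: "x \<in> set w \<Longrightarrow> y \<in> set w \<Longrightarrow> x \<noteq> y \<Longrightarrow> precedes w x y \<or> precedes w y x"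
  by (induction w) auto

lemma precedes_trans: "distinct w \<Longrightarrow> precedes w x y \<Longrightarrow> precedes w y z \<Longrightarrow> precedes w x z"
  by (induction w) (auto dest: precedes_in_set)

lemma precedes_take: "distinct w \<Longrightarrow> precedes w x y \<Longrightarrow> y \<in> set (take k w) \<Longrightarrow> x \<in> set (take k w)"
proof (induction w arbitrary: k)
  case (Cons a w)
  then show ?case by (cases k) (auto dest: precedes_in_set in_set_takeD)
qed simp

lemma precedes_eqD:
  assumes "distinct v" "distinct w" "set v = set w" "\<And>x y. precedes v x y \<longleftrightarrow> precedes w x y"
  shows "v = w"
  using assms
proof (induction v arbitrary: w)
  case (Cons a v)
  then obtain b u where w: "w = b # u" by (cases w) auto
  have "a = b"
  proof (rule ccontr)
    assume "a \<noteq> b"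
    then have "precedes w b a" using w Cons.prems(3) by auto
    then show False using Cons.prems(1,4) \<open>a \<noteq> b\<close> by (auto dest: precedes_in_set)
  qed
  moreover have "v = u"
  proof (rule Cons.IH)
    show "set v = set u" using Cons.prems(1-3) w \<open>a = b\<close> by auto
    have "x \<noteq> a" if "precedes v x y \<or> precedes u x y" for x y
      using that precedes_in_set[of v x y] precedes_in_set[of u x y] Cons.prems(1,2) w \<open>a = b\<close> by auto
    then show "precedes v x y \<longleftrightarrow> precedes u x y" for x y
      using Cons.prems(4)[of x y] unfolding w \<open>a = b\<close>[symmetric] precedes.simps by blast
  qed (use Cons.prems w in auto)
  ultimately show ?case using w by simp
qed simp

lemma sorted_wrt_precedes: "sorted_wrt R w \<longleftrightarrow> (\<forall>x y. precedes w x y \<longrightarrow> R x y)"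
  by (induction w) auto

text \<open>If all neighbours were related, transitivity would relate all pairs. Steps exchange only
  neighbouring labels, so a violated neighbouring pair is what is wanted. Transitivity is asked for
  the letters of \<open>w\<close> alone, since a target controls its relation only there.\<close>

lemma not_sorted_wrt_adjacent:
  assumes "\<forall>x\<in>set w. \<forall>y\<in>set w. \<forall>z\<in>set w. R x y \<longrightarrow> R y z \<longrightarrow> R x z" "\<not> sorted_wrt R w"
  shows "\<exists>us x y vs. w = us @ x # y # vs \<and> \<not> R x y"
  using assms
proof (induction w)
  case (Cons x w)
  show ?case
  proof (cases "sorted_wrt R w")
    case False
    have trans: "\<forall>x\<in>set w. \<forall>y\<in>set w. \<forall>z\<in>set w. R x y \<longrightarrow> R y z \<longrightarrow> R x z"
      using Cons.prems(1) by (meson list.set_intros(2))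
    obtain us y z vs where "w = us @ y # z # vs" "\<not> R y z" using Cons.IH[OF trans False] by blast
    then show ?thesis by (metis append_Cons)
  next
    case True
    then obtain y v where w: "w = y # v" using Cons.prems(2) by (cases w) auto
    have "R x z" if "R x y" "z \<in> set v" for z
    proof -
      have "R y z" using True w that(2) by simp
      then show ?thesis using Cons.prems(1) w that by (meson list.set_intros)
    qed
    then have "\<not> R x y" using Cons.prems(2) w True by auto
    then show ?thesis using w by (metis append_Nil)
  qed
qed simp

text \<open>Converts \<open>above t w i \<subseteq> H i\<close> into a lower bound for
  \<open>cuts_under t i\<close>, the numerical form of domination used in
  \<open>rots_towards\<close>.\<close>

lemma subset_takeWhile_iff:
  "k \<le> length w \<Longrightarrow> set (take k w) \<subseteq> S \<longleftrightarrow> k \<le> length (takeWhile (\<lambda>x. x \<in> S) w)"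
proof (induction w arbitrary: k)
  case (Cons a w)
  then show ?case by (cases k) auto
qed simp

lemma length_takeWhile_mono:
  "S \<subseteq> S' \<Longrightarrow> length (takeWhile (\<lambda>x. x \<in> S) w) \<le> length (takeWhile (\<lambda>x. x \<in> S') w)"
  by (induction w) auto

text \<open>In a sorted word, a set closed towards earlier letters is a prefix, so stopping at the
  first failure loses nothing.\<close>

lemma takeWhile_sorted_wrt:
  "sorted_wrt R w \<Longrightarrow> (\<forall>x\<in>set w. \<forall>y\<in>set w. R x y \<longrightarrow> P y \<longrightarrow> P x) \<Longrightarrow>
    set (takeWhile P w) = {x \<in> set w. P x}"
  by (induction w) auto

section \<open>Trees with labelled cuts and abstract targets\<close>

type_synonym state = "cut_tree \<times> nat list"

definition above :: "cut_tree \<Rightarrow> nat list \<Rightarrow> nat \<Rightarrow> nat set" where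
  "above t w i = set (take (length w - cuts_under t i) w)"

definition well_formed :: "nat set \<Rightarrow> nat \<Rightarrow> cut_tree \<Rightarrow> nat list \<Rightarrow> bool" where
  "well_formed A n t w \<longleftrightarrow>
     uniform t \<and> forks t = n \<and> depth t = length w \<and> distinct w \<and> set w = A"

text \<open>A binary node between the cuts labelled \<open>b\<close> and \<open>a\<close> has
  precisely the cuts labelled by \<open>a\<close> and \<open>v\<close> beneath it, so the side
  condition of \<open>step_exchange\<close> forbids such nodes.\<close>

inductive step :: "state \<Rightarrow> state \<Rightarrow> bool" where
  step_rot: "rot t t' \<Longrightarrow> step (t, w) (t', w)"
| step_exchange: "a < b \<Longrightarrow> \<forall>i<forks t. cuts_under t i \<noteq> Suc (length v) \<Longrightarrow>
    step (t, u @ b # a # v) (t, u @ a # b # v)"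

text \<open>
  Abstract data of a painted tree: \<open>R\<close> orders the labels downward, \<open>H i\<close> is the set of
  labels above node \<open>i\<close>, and \<open>r\<close> is the bracket vector.
\<close>

definition target :: "nat set \<Rightarrow> nat \<Rightarrow> (nat \<Rightarrow> nat \<Rightarrow> bool) \<Rightarrow> (nat \<Rightarrow> nat set) \<Rightarrow> (nat \<Rightarrow> nat) \<Rightarrow> bool"
  where "target A n R H r \<longleftrightarrow>
    bracket n r \<and> compat n r (\<lambda>i j. H j \<subseteq> H i) \<and>
    (\<forall>x\<in>A. \<forall>y\<in>A. x \<noteq> y \<longrightarrow> (R x y \<longleftrightarrow> \<not> R y x)) \<and>
    (\<forall>x\<in>A. \<forall>y\<in>A. \<forall>z\<in>A. R x y \<longrightarrow> R y z \<longrightarrow> R x z) \<and> (\<forall>x\<in>A. \<not> R x x) \<and>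
    (\<forall>i<n. H i \<subseteq> A \<and> (\<forall>x\<in>A. \<forall>y\<in>H i. R x y \<longrightarrow> x \<in> H i))"

text \<open>For a linear \<open>R\<close> the pairs with the larger label above are the complement
  of the pairs compared here, so containment of the pairs \<open>x < y\<close> captures the whole
  comparison of labels.\<close>

definition within :: "nat \<Rightarrow> cut_tree \<Rightarrow> nat list \<Rightarrow> (nat \<Rightarrow> nat \<Rightarrow> bool) \<Rightarrow> (nat \<Rightarrow> nat set) \<Rightarrow> (nat \<Rightarrow> nat) \<Rightarrow> bool"
  where "within n t w R H r \<longleftrightarrow>
    (\<forall>x y. x < y \<longrightarrow> precedes w x y \<longrightarrow> R x y) \<and> (\<forall>i<n. above t w i \<subseteq> H i \<and> reach t i \<le> r i)"

lemma target_state: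
  assumes "well_formed A n t w"
  shows "target A n (precedes w) (above t w) (reach t)"
proof -
  have "compat n (reach t) (\<lambda>i j. above t w j \<subseteq> above t w i)"
    using compat_cuts_under[of t] assms
    unfolding compat_def above_def well_formed_def by (meson diff_le_mono2 set_take_subset_set_take)
  moreover have "\<forall>i<n. above t w i \<subseteq> A" using assms by (auto simp: well_formed_def above_def dest: in_set_takeD)
  moreover have "bracket n (reach t)" using assms bracket_reach by (auto simp: well_formed_def)
  moreover have "precedes w x y \<longleftrightarrow> \<not> precedes w y x" if "x \<in> A" "y \<in> A" "x \<noteq> y" for x y
    using precedes_asym[of w x y] precedes_total[of x w y] assms that by (auto simp: well_formed_def)
  moreover have "\<not> precedes w x x" for x
    using precedes_asym[of w x x] assms by (auto simp: well_formed_def)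
  moreover have "precedes w x z" if "precedes w x y" "precedes w y z" for x y z
    using precedes_trans[of w x y z] assms that by (simp add: well_formed_def)
  moreover have "x \<in> above t w i" if "precedes w x y" "y \<in> above t w i" for x y i
    using precedes_take[of w x y] assms that by (simp add: above_def well_formed_def)
  ultimately show ?thesis unfolding target_def by blast
qed

lemma step_well_formed:
  assumes "step (t, w) (t', w')" "well_formed A n t w"
  shows "well_formed A n t' w'"
  using assms by cases (auto simp: well_formed_def rot_forks rot_depth rot_uniform)

lemma step_within:
  assumes "step (t, w) (t', w')" "well_formed A n t w"
  shows "within n t w (precedes w') (above t' w') (reach t')"
  using assms(1)
proof cases
  case step_rot
  then have "above t w i \<subseteq> above t' w i \<and> reach t i \<le> reach t' i" if "i < n" for i
    using rot_mono[of t t' i] assms(2) that unfolding above_def well_formed_def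
    by (auto intro!: set_take_subset_set_take)
  then show ?thesis using step_rot by (simp add: within_def)
next
  case (step_exchange a b v u)
  have "above t w i = above t w' i" if "i < n" for i
  proof -
    define k where "k = length w - cuts_under t i"
    have "cuts_under t i \<noteq> Suc (length v)" using step_exchange assms(2) that by (auto simp: well_formed_def)
    \<comment> \<open>No node sits between the two cuts, so the prefix above node \<open>i\<close>
      contains both exchanged labels or neither.\<close>
    then have "k \<le> length u \<or> k \<ge> Suc (Suc (length u))" using step_exchange by (auto simp: k_def)
    then have "set (take k w) = set (take k w')"
      using step_exchange by (auto simp: take_Cons' insert_commute)
    then show ?thesis using step_exchange by (simp add: above_def k_def)
  qed
  then show ?thesis using step_exchange by (auto simp: within_def precedes_append)
qed

lemma compat_mono: "compat n r P \<Longrightarrow> (\<And>i j. P i j \<Longrightarrow> Q i j) \<Longrightarrow> compat n r Q"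
  by (simp add: compat_def)

lemma steps_well_formed:
  assumes "step\<^sup>*\<^sup>* (t, w) (t', w')" "well_formed A n t w"
  shows "well_formed A n t' w'"
  using assms by (induction rule: rtranclp_induct2) (auto dest: step_well_formed)

lemma within_trans:
  assumes "within n t w (precedes w') (above t' w') (reach t')" "within n t' w' R H r"
  shows "within n t w R H r"
  using assms unfolding within_def by (meson order_trans)

lemma within_refl: "within n t w (precedes w) (above t w) (reach t)"
  by (simp add: within_def)

lemma steps_within:
  assumes "step\<^sup>*\<^sup>* (t, w) (t', w')" "well_formed A n t w"
  shows "within n t w (precedes w') (above t' w') (reach t')"
  using assms
proof (induction rule: rtranclp_induct2)
  case refl
  show ?case by (rule within_refl)
next
  case (step t1 w1 t2 w2)
  then show ?case using within_trans step_within steps_well_formed by metis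
qed

lemma step_rots: "rot\<^sup>*\<^sup>* t t' \<Longrightarrow> step\<^sup>*\<^sup>* (t, w) (t', w)"
  by (induction rule: rtranclp_induct) (auto intro: rtranclp.rtrancl_into_rtrancl step_rot)

definition attains :: "nat set \<Rightarrow> nat \<Rightarrow> cut_tree \<Rightarrow> nat list \<Rightarrow> (nat \<Rightarrow> nat \<Rightarrow> bool) \<Rightarrow> (nat \<Rightarrow> nat set) \<Rightarrow> (nat \<Rightarrow> nat) \<Rightarrow> bool"
  where "attains A n t w R H r \<longleftrightarrow>
    (\<forall>x\<in>A. \<forall>y\<in>A. precedes w x y \<longleftrightarrow> R x y) \<and> (\<forall>i<n. above t w i = H i \<and> reach t i = r i)"

text \<open>For a fixed word the tree is raised as far as the word allows, which
  \<open>rots_towards\<close> does exactly. If the word is sorted along \<open>R\<close>, the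
  \<open>R\<close>-closed sets \<open>H i\<close> are prefixes and the target is attained; otherwise
  two neighbouring labels in the wrong order are exchanged. The measure counts the pairs not yet
  inverted.\<close>

lemma steps_towards:
  assumes tgt: "target A n R H r" and "well_formed A n t w" "within n t w R H r"
  shows "\<exists>t' w'. step\<^sup>*\<^sup>* (t, w) (t', w') \<and> attains A n t' w' R H r"
  using assms(2-)
proof (induction "card {p \<in> A \<times> A. fst p < snd p \<and> \<not> precedes w (fst p) (snd p)}"
    arbitrary: t w rule: less_induct)
  case less
  have finA: "finite A" using less.prems by (auto simp: well_formed_def)
  have w: "distinct w" "set w = A" using less.prems by (auto simp: well_formed_def)
  have R: "R x y \<longleftrightarrow> \<not> R y x" if "x \<in> A" "y \<in> A" "x \<noteq> y" for x y
    using tgt that unfolding target_def by blast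
  have up: "x \<in> H i" if "i < n" "x \<in> A" "y \<in> H i" "R x y" for x y i
    using tgt that unfolding target_def by blast
  have HA: "H i \<subseteq> A" if "i < n" for i
    using tgt that unfolding target_def by blast
  have Rtrans: "\<forall>x\<in>A. \<forall>y\<in>A. \<forall>z\<in>A. R x y \<longrightarrow> R y z \<longrightarrow> R x z"
    using tgt unfolding target_def by blast
  have inv: "precedes w x y \<Longrightarrow> x < y \<Longrightarrow> R x y" for x y
    using less.prems(2) unfolding within_def by blast
  have brk: "bracket n r" using tgt by (simp only: target_def)
  \<comment> \<open>The longest prefix of \<open>w\<close> inside \<open>H i\<close> is the best
    that node \<open>i\<close> can achieve while the word stays \<open>w\<close>. It depends
    monotonically on \<open>H i\<close>, so compatibility carries over to \<open>e\<close>.\<close>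
  define top where "top = (\<lambda>i. length (takeWhile (\<lambda>x. x \<in> H i) w))"
  define e where "e = (\<lambda>i. length w - top i)"
  have top: "top i \<le> length w" for i by (simp add: top_def length_takeWhile_le)
  have "compat n r (\<lambda>i j. H j \<subseteq> H i)" using tgt by (simp add: target_def)
  moreover have "e i \<le> e j" if "H j \<subseteq> H i" for i j
    unfolding e_def top_def by (intro diff_le_mono2 length_takeWhile_mono that)
  ultimately have "compat n r (\<lambda>i j. e i \<le> e j)"
    by (rule compat_mono)
  moreover have "\<forall>i<n. reach t i \<le> r i \<and> e i \<le> cuts_under t i"
  proof (intro allI impI conjI)
    fix i assume "i < n"
    then show "reach t i \<le> r i" using less.prems by (simp add: within_def)
    have "length w - cuts_under t i \<le> top i"
      using subset_takeWhile_iff[of "length w - cuts_under t i" w "H i"] less.prems(2) \<open>i < n\<close>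
      by (simp add: within_def above_def top_def)
    then show "e i \<le> cuts_under t i" by (simp add: e_def)
  qed
  ultimately obtain t1 where t1: "rot\<^sup>*\<^sup>* t t1" "\<forall>i<n. cuts_under t1 i = e i \<and> reach t1 i = r i"
    using rots_towards[of n r e t] less.prems brk by (auto simp: well_formed_def)
  have steps1: "step\<^sup>*\<^sup>* (t, w) (t1, w)" using t1(1) by (rule step_rots)
  have wf1: "well_formed A n t1 w" using steps1 less.prems(1) by (rule steps_well_formed)
  have above1: "above t1 w i = set (takeWhile (\<lambda>x. x \<in> H i) w)" if "i < n" for i
  proof -
    have "above t1 w i = set (take (top i) w)"
      using t1(2) that top[of i] by (simp add: above_def e_def)
    then show ?thesis unfolding top_def takeWhile_eq_take[symmetric] .
  qed
  show ?case
  proof (cases "sorted_wrt R w")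
    case True
    have precR: "R x y" if "precedes w x y" for x y
      using True that by (simp add: sorted_wrt_precedes)
    moreover have "precedes w x y" if "R x y" "x \<in> A" "y \<in> A" for x y
    proof -
      have "x \<noteq> y" using tgt that unfolding target_def by blast
      then have "\<not> R y x" using R that by blast
      then show ?thesis using precedes_total[of x w y] that w \<open>x \<noteq> y\<close> precR by blast
    qed
    moreover have "above t1 w i = H i" if "i < n" for i
    proof -
      have "set (takeWhile (\<lambda>x. x \<in> H i) w) = {x \<in> set w. x \<in> H i}"
        by (rule takeWhile_sorted_wrt[OF True]) (use up that w in blast)
      then show ?thesis using above1[OF that] HA[OF that] w by blast
    qed
    ultimately have "attains A n t1 w R H r" using t1(2) unfolding attains_def by blast
    then show ?thesis using steps1 by blast
  next
    case False
    have "\<forall>x\<in>set w. \<forall>y\<in>set w. \<forall>z\<in>set w. R x y \<longrightarrow> R y z \<longrightarrow> R x z"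
      unfolding w(2) by (rule Rtrans)
    from not_sorted_wrt_adjacent[OF this False]
    obtain u b a v where uv: "w = u @ b # a # v" "\<not> R b a" by blast
    define w2 where "w2 = u @ a # b # v"
    have ab: "a \<in> A" "b \<in> A" "a \<noteq> b" using w uv by auto
    then have Rab: "R a b" using R uv by blast
    have "precedes w b a" using uv by (simp add: precedes_append)
    then have "\<not> b < a" using inv uv by blast
    then have "a < b" using ab by simp
    \<comment> \<open>For a node between the two cuts the prefix would end with \<open>b\<close>.
      But \<open>b \<in> H i\<close> and \<open>R a b\<close> put \<open>a\<close> into
      \<open>H i\<close>, so the longest prefix inside \<open>H i\<close> would go on past
      \<open>a\<close>.\<close>
    have gap: "cuts_under t1 i \<noteq> Suc (length v)" if i: "i < n" for i
    proof
      assume "cuts_under t1 i = Suc (length v)"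
      then have "top i = Suc (length u)" using t1(2) i top[of i] uv by (simp add: e_def)
      then have "takeWhile (\<lambda>x. x \<in> H i) w = u @ [b]"
        using takeWhile_eq_take[of "\<lambda>x. x \<in> H i" w] uv by (simp add: top_def)
      then have *: "above t1 w i = set (u @ [b])" using above1 i by simp
      then have "b \<in> H i" using above1[OF i] set_takeWhileD[of b "\<lambda>x. x \<in> H i" w] by auto
      then have "a \<in> H i" using up i Rab ab by blast
      moreover have "\<forall>x\<in>set (u @ [b]). x \<in> H i"
        using * above1[OF i] set_takeWhileD[of _ "\<lambda>x. x \<in> H i" w] by blast
      ultimately have "takeWhile (\<lambda>x. x \<in> H i) w = u @ [b, a] @ takeWhile (\<lambda>x. x \<in> H i) v"
        using uv by (simp add: takeWhile_append)
      then show False using \<open>takeWhile (\<lambda>x. x \<in> H i) w = u @ [b]\<close> by simp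
    qed
    then have step: "step (t1, w) (t1, w2)"
      using gap \<open>a < b\<close> wf1 uv unfolding w2_def by (auto intro!: step_exchange simp: well_formed_def)
    have wf2: "well_formed A n t1 w2" using step wf1 by (rule step_well_formed)
    have prec2: "precedes w2 x y" if "precedes w x y" "x < y" for x y
      using that \<open>a < b\<close> uv by (auto simp: w2_def precedes_append)
    have "within n t1 w2 R H r"
      unfolding within_def
    proof (intro conjI allI impI)
      fix x y assume "x < y" "precedes w2 x y"
      then have "precedes w x y \<or> x = a \<and> y = b" using uv by (auto simp: w2_def precedes_append)
      then show "R x y" using inv Rab \<open>x < y\<close> by blast
    next
      fix i assume i: "i < n"
      show "reach t1 i \<le> r i" using t1(2) i by simp
      have "above t1 w i \<subseteq> H i" using above1[OF i] set_takeWhileD by fastforce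
      moreover have "above t1 w2 i = above t1 w i"
      proof -
        define k where "k = length w - cuts_under t1 i"
        then have "k \<le> length u \<or> k \<ge> Suc (Suc (length u))" using uv gap[OF i] by auto
        then have "set (take k w) = set (take k w2)"
          using uv by (auto simp: w2_def take_Cons' insert_commute)
        then show ?thesis using uv by (simp add: above_def k_def w2_def)
      qed
      ultimately show "above t1 w2 i \<subseteq> H i" by simp
    qed
    moreover have "card {p \<in> A \<times> A. fst p < snd p \<and> \<not> precedes w2 (fst p) (snd p)} <
        card {p \<in> A \<times> A. fst p < snd p \<and> \<not> precedes w (fst p) (snd p)}"
    proof (rule psubset_card_mono)
      show "finite {p \<in> A \<times> A. fst p < snd p \<and> \<not> precedes w (fst p) (snd p)}"
        using finA by simp
      have "\<not> precedes w a b" using precedes_asym w(1) \<open>precedes w b a\<close> by fast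
      moreover have "precedes w2 a b" by (simp add: w2_def precedes_append)
      ultimately have "(a, b) \<in> {p \<in> A \<times> A. fst p < snd p \<and> \<not> precedes w (fst p) (snd p)}"
        "(a, b) \<notin> {p \<in> A \<times> A. fst p < snd p \<and> \<not> precedes w2 (fst p) (snd p)}"
        using ab \<open>a < b\<close> by auto
      moreover have "{p \<in> A \<times> A. fst p < snd p \<and> \<not> precedes w2 (fst p) (snd p)} \<subseteq>
        {p \<in> A \<times> A. fst p < snd p \<and> \<not> precedes w (fst p) (snd p)}"
        using prec2 by auto
      ultimately show "{p \<in> A \<times> A. fst p < snd p \<and> \<not> precedes w2 (fst p) (snd p)} \<subset>
        {p \<in> A \<times> A. fst p < snd p \<and> \<not> precedes w (fst p) (snd p)}"
        by blast
    qed
    ultimately obtain t3 w3 where "step\<^sup>*\<^sup>* (t1, w2) (t3, w3)" "attains A n t3 w3 R H r"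
      using less.hyps wf2 by blast
    then show ?thesis using steps1 step by (meson converse_rtranclp_into_rtranclp rtranclp_trans)
  qed
qed

text \<open>The relation \<open>precedes\<close> determines the word. As its letters are distinct,
  the size of \<open>above t w i\<close> then determines \<open>cuts_under t i\<close>, and
  \<open>cut_tree_eqI\<close> applies.\<close>

lemma attains_unique:
  assumes "well_formed A n t w" "well_formed A n t' w'"
    and "attains A n t w R H r" "attains A n t' w' R H r"
  shows "t = t' \<and> w = w'"
proof
  show w: "w = w'"
  proof (rule precedes_eqD)
    show "precedes w x y \<longleftrightarrow> precedes w' x y" for x y
    proof (cases "x \<in> A \<and> y \<in> A")
      case True
      then show ?thesis using assms(3,4) by (simp add: attains_def)
    next
      case False
      then show ?thesis using assms(1,2) precedes_in_set by (metis well_formed_def)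
    qed
  qed (use assms in \<open>auto simp: well_formed_def\<close>)
  show "t = t'"
  proof (rule cut_tree_eqI)
    show "\<forall>i<forks t. reach t i = reach t' i \<and> cuts_under t i = cuts_under t' i"
    proof (intro allI impI)
      fix i assume i: "i < forks t"
      have len: "distinct w" "cuts_under t i \<le> length w" "cuts_under t' i \<le> length w"
        using assms(1,2) w i cuts_under_le[of t i] cuts_under_le[of t' i] by (auto simp: well_formed_def)
      have "above t w i = above t' w i" using assms w i by (simp add: attains_def well_formed_def)
      then have "card (set (take (length w - cuts_under t i) w)) = card (set (take (length w - cuts_under t' i) w))"
        by (simp add: above_def)
      then have "length w - cuts_under t i = length w - cuts_under t' i"
        using len(1) by (simp add: distinct_card)
      then show "reach t i = reach t' i \<and> cuts_under t i = cuts_under t' i"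
        using len assms i by (simp add: attains_def well_formed_def)
    qed
  qed (use assms w in \<open>auto simp: well_formed_def\<close>)
qed

lemma attains_self: "attains A n t w (precedes w) (above t w) (reach t)"
  by (simp add: attains_def)

lemma steps_antisym:
  assumes "well_formed A n t w" "step\<^sup>*\<^sup>* (t, w) (t', w')" "step\<^sup>*\<^sup>* (t', w') (t, w)"
  shows "t = t' \<and> w = w'"
proof -
  have wf': "well_formed A n t' w'" using assms(2,1) by (rule steps_well_formed)
  have 1: "within n t w (precedes w') (above t' w') (reach t')"
    using assms(2,1) by (rule steps_within)
  have 2: "within n t' w' (precedes w) (above t w) (reach t)"
    using assms(3) wf' by (rule steps_within)
  have "precedes w x y \<longleftrightarrow> precedes w' x y" if "x \<in> A" "y \<in> A" for x y
  proof (cases x y rule: linorder_cases)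
    case less
    then show ?thesis using 1 2 by (auto simp: within_def)
  next
    case equal
    then show ?thesis using assms(1) wf' precedes_asym by (metis well_formed_def)
  next
    case greater
    then have "precedes w y x \<longleftrightarrow> precedes w' y x" using 1 2 by (auto simp: within_def)
    moreover have "precedes v x y \<longleftrightarrow> \<not> precedes v y x" if "v \<in> {w, w'}" for v
      using precedes_asym[of v x y] precedes_total[of x v y] that assms(1) wf' \<open>x \<in> A\<close> \<open>y \<in> A\<close> greater
      by (auto simp: well_formed_def)
    ultimately show ?thesis by blast
  qed
  then have "attains A n t w (precedes w') (above t' w') (reach t')"
    using 1 2 unfolding attains_def within_def by (simp add: order_antisym)
  then show ?thesis using attains_unique assms(1) wf' attains_self by blast
qed


section \<open>Meets\<close>

text \<open>The noninversions of the meet: the pairs \<open>x < y\<close> of labels with \<open>y\<close> above \<open>x\<close>.\<close>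

definition meet_unders :: "nat set \<Rightarrow> (nat \<Rightarrow> nat \<Rightarrow> bool) \<Rightarrow> (nat \<Rightarrow> nat \<Rightarrow> bool) \<Rightarrow> nat \<Rightarrow> nat \<Rightarrow> bool"
  where "meet_unders A R R' = (\<lambda>x y. x \<in> A \<and> y \<in> A \<and> x < y \<and> (R y x \<or> R' y x))\<^sup>+\<^sup>+"

definition meet_order :: "nat set \<Rightarrow> (nat \<Rightarrow> nat \<Rightarrow> bool) \<Rightarrow> (nat \<Rightarrow> nat \<Rightarrow> bool) \<Rightarrow> nat \<Rightarrow> nat \<Rightarrow> bool"
  where "meet_order A R R' x y \<longleftrightarrow> x < y \<and> \<not> meet_unders A R R' x y \<or> meet_unders A R R' y x"

text \<open>
  The excluded labels \<open>a\<close> are those forced below node \<open>j\<close>: some \<open>b\<close> is not above \<open>i\<close> in one of the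
  two trees, \<open>a\<close> is below \<open>b\<close>, and \<open>i\<close> is a left descendant of \<open>j\<close>.
\<close>

definition meet_above ::
  "nat set \<Rightarrow> (nat \<Rightarrow> nat \<Rightarrow> bool) \<Rightarrow> (nat \<Rightarrow> nat \<Rightarrow> bool) \<Rightarrow> (nat \<Rightarrow> nat set) \<Rightarrow> (nat \<Rightarrow> nat set) \<Rightarrow>
    (nat \<Rightarrow> nat) \<Rightarrow> nat \<Rightarrow> nat set"
  where "meet_above A R R' H H' r j =
    {a \<in> A. \<not> (\<exists>b\<in>A. \<exists>i. (a = b \<or> meet_unders A R R' a b) \<and> (b \<notin> H i \<or> b \<notin> H' i) \<and> lies_left r i j)}"

lemma meet_undersD: "meet_unders A R R' x y \<Longrightarrow> x \<in> A \<and> y \<in> A \<and> x < y"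
  unfolding meet_unders_def by (induction rule: tranclp_induct) auto

lemma meet_unders_trans: "meet_unders A R R' x y \<Longrightarrow> meet_unders A R R' y z \<Longrightarrow> meet_unders A R R' x z"
  unfolding meet_unders_def by (rule tranclp_trans)

lemma meet_unders_step:
  "x \<in> A \<Longrightarrow> y \<in> A \<Longrightarrow> x < y \<Longrightarrow> R y x \<or> R' y x \<Longrightarrow> meet_unders A R R' x y"
  unfolding meet_unders_def by (rule tranclp.r_into_trancl) simp

lemma linear_cotrans:
  assumes "target A n R H r" "x \<in> A" "y \<in> A" "z \<in> A" "R z x" "x \<noteq> y" "y \<noteq> z"
  shows "R y x \<or> R z y"
proof -
  have "R x y \<longleftrightarrow> \<not> R y x" "R y z \<longleftrightarrow> \<not> R z y" "x \<noteq> z" "R x z \<longleftrightarrow> \<not> R z x"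
      "R x y \<Longrightarrow> R y z \<Longrightarrow> R x z"
    using assms unfolding target_def by metis+
  then show ?thesis using assms(5) by blast
qed

text \<open>A chain of noninversions from \<open>x\<close> to \<open>z\<close> has a link that jumps
  over \<open>y\<close> or ends in \<open>y\<close>; a link that jumps over \<open>y\<close> comes
  from one of the two linear orders and splits there at \<open>y\<close>. This is what makes the
  transitive closure of the joined noninversions belong to a linear order again.\<close>

lemma meet_unders_cotrans:
  assumes "target A n R H r" "target A n R' H' r'"
    and "meet_unders A R R' x z" "x < y" "y < z" "y \<in> A"
  shows "meet_unders A R R' x y \<or> meet_unders A R R' y z"
proof -
  define B where "B = (\<lambda>x y. x \<in> A \<and> y \<in> A \<and> x < y \<and> (R y x \<or> R' y x))"
  have co: "B u y \<or> B y v" if "B u v" "u < y" "y < v" for u v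
    using linear_cotrans[OF assms(1), of u y v] linear_cotrans[OF assms(2), of u y v] assms(6) that
    unfolding B_def by blast
  have "B\<^sup>+\<^sup>+ x z" using assms(3) by (simp add: B_def meet_unders_def)
  then have "B\<^sup>+\<^sup>+ x y \<or> B\<^sup>+\<^sup>+ y z" using assms(4,5)
  proof (induction rule: tranclp_induct)
    case (base z)
    then show ?case using co by blast
  next
    case (step u z)
    consider "y < u" | "y = u" | "u < y" by linarith
    then show ?case
    proof cases
      case 1
      then show ?thesis using step.IH[OF step.prems(1)] tranclp.trancl_into_trancl[of B y u z] step.hyps(2) by blast
    next
      case 2
      then show ?thesis using step.hyps(1) by blast
    next
      case 3
      then show ?thesis using co[OF step.hyps(2) 3 step.prems(2)]
          step.hyps(1) tranclp.trancl_into_trancl[of B x u y] by blast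
    qed
  qed
  then show ?thesis by (simp add: B_def meet_unders_def)
qed

lemma lies_left_trans: "bracket n r \<Longrightarrow> lies_left r i j \<Longrightarrow> lies_left r j k \<Longrightarrow> lies_left r i k"
  unfolding lies_left_def by (metis linorder_not_le order_less_le_trans order_trans)

lemma bracket_min:
  assumes "bracket n r" "bracket n r'"
  shows "bracket n (\<lambda>i. min (r i) (r' i))"
proof -
  have "j + min (r j) (r' j) \<le> i + min (r i) (r' i)"
    if "i < j" "j \<le> i + min (r i) (r' i)" "j < n" for i j
  proof -
    have "j \<le> i + r i" "j \<le> i + r' i" using that by simp_all
    then have "j + r j \<le> i + r i" "j + r' j \<le> i + r' i"
      using assms that(1,3) unfolding bracket_def by blast+
    then show ?thesis by linarith
  qed
  moreover have "i + min (r i) (r' i) < n" if "i < n" for i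
  proof -
    have "i + r i < n" using assms(1) that unfolding bracket_def by blast
    then show ?thesis by linarith
  qed
  ultimately show ?thesis unfolding bracket_def by blast
qed

text \<open>Right descendants for the minimum are right descendants for both vectors, so they ask
  for no correction. Left descendants become more numerous, and the exclusions in
  \<open>meet_above\<close> are passed along exactly these.\<close>

lemma target_meet:
  assumes 1: "target A n R H r" and 2: "target A n R' H' r'"
  shows "target A n (meet_order A R R') (meet_above A R R' H H' (\<lambda>i. min (r i) (r' i)))
    (\<lambda>i. min (r i) (r' i))"
proof -
  define q where "q = (\<lambda>i. min (r i) (r' i))"
  define N where "N = meet_unders A R R'"
  define Q where "Q = meet_order A R R'"
  define K where "K = meet_above A R R' H H' q"
  have ND: "x \<in> A \<and> y \<in> A \<and> x < y" if "N x y" for x y using that meet_undersD by (simp add: N_def)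
  have Ntrans: "N x z" if "N x y" "N y z" for x y z using that meet_unders_trans unfolding N_def by metis
  have Nco: "N x y \<or> N y z" if "N x z" "x < y" "y < z" "y \<in> A" for x y z
    using meet_unders_cotrans[OF 1 2] that unfolding N_def by blast
  have Nstep: "N x y" if "x \<in> A" "y \<in> A" "x < y" "R y x \<or> R' y x" for x y
    using that meet_unders_step unfolding N_def by metis
  have Q: "Q x y \<longleftrightarrow> x < y \<and> \<not> N x y \<or> N y x" for x y by (simp add: Q_def N_def meet_order_def)
  have K: "a \<notin> K j \<longleftrightarrow> (\<exists>b\<in>A. \<exists>i. (a = b \<or> N a b) \<and> (b \<notin> H i \<or> b \<notin> H' i) \<and> lies_left q i j)"
    if "a \<in> A" for a j using that by (simp add: K_def N_def meet_above_def)
  have KA: "K j \<subseteq> A" for j by (auto simp: K_def meet_above_def)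
  have brq: "bracket n q" using bracket_min 1 2 unfolding q_def target_def by metis
  have asym: "Q x y \<longleftrightarrow> \<not> Q y x" if "x \<noteq> y" for x y
    using that ND unfolding Q by (metis less_asym linorder_neq_iff)
  have irr: "\<not> Q x x" for x using ND unfolding Q by blast
  \<comment> \<open>There is one case for each order of \<open>x\<close>, \<open>y\<close>,
    \<open>z\<close> as numbers. In three of them the negated claim violates transitivity of
    \<open>N\<close>, in the other three cotransitivity.\<close>
  have tr: "Q x z" if "Q x y" "Q y z" "x \<in> A" "y \<in> A" "z \<in> A" for x y z
  proof (rule ccontr)
    assume not: "\<not> Q x z"
    have ne: "x \<noteq> y" "y \<noteq> z" "x \<noteq> z" using that irr asym by metis+
    then have "x < y \<and> y < z \<or> x < z \<and> z < y \<or> y < x \<and> x < z \<or> y < z \<and> z < x \<or>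
      z < x \<and> x < y \<or> z < y \<and> y < x" by linarith
    have Qlt: "Q u v \<longleftrightarrow> \<not> N u v" "Q v u \<longleftrightarrow> N u v" if "u < v" for u v
      using that ND unfolding Q by (meson less_asym)+
    show False
      using \<open>x < y \<and> y < z \<or> x < z \<and> z < y \<or> y < x \<and> x < z \<or> y < z \<and> z < x \<or> z < x \<and> x < y \<or> z < y \<and> y < x\<close>
    proof (elim disjE conjE)
      assume "x < y" "y < z"
      then show False using that not Qlt[of x y] Qlt[of y z] Qlt[of x z] Nco[of x z y] by simp
    next
      assume "x < z" "z < y"
      then show False using that not Qlt[of x y] Qlt[of z y] Qlt[of x z] Ntrans[of x z y] by simp
    next
      assume "y < x" "x < z"
      then show False using that not Qlt[of y x] Qlt[of y z] Qlt[of x z] Ntrans[of y x z] by simp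
    next
      assume "y < z" "z < x"
      then show False using that not Qlt[of y x] Qlt[of y z] Qlt[of z x] Nco[of y x z] by simp
    next
      assume "z < x" "x < y"
      then show False using that not Qlt[of x y] Qlt[of z y] Qlt[of z x] Nco[of z y x] by simp
    next
      assume "z < y" "y < x"
      then show False using that not Qlt[of y x] Qlt[of z y] Qlt[of z x] Ntrans[of z y x] by simp
    qed
  qed
  have up: "x \<in> K j" if "x \<in> A" "y \<in> K j" "Q x y" "j < n" for x y j
  proof (rule ccontr)
    assume "x \<notin> K j"
    then obtain b i where b: "b \<in> A" "x = b \<or> N x b" "b \<notin> H i \<or> b \<notin> H' i" "lies_left q i j"
      using K[OF \<open>x \<in> A\<close>] by blast
    have yA: "y \<in> A" using that KA by blast
    have yK: "\<not> ((y = c \<or> N y c) \<and> (c \<notin> H i \<or> c \<notin> H' i))" if "c \<in> A" for c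
      using K[OF yA, of j] \<open>y \<in> K j\<close> that b(4) by blast
    have i: "i < n" using b(4) that(4) by (simp add: lies_left_def)
    show False
    proof (cases "N y x")
      case True
      then have "N y b" using b(2) Ntrans by blast
      then show ?thesis using yK b by blast
    next
      case False
      then have xy: "x < y" "\<not> N x y" using that(3) Q by blast+
      consider "y < b" | "y = b" | "b < y" by linarith
      then show ?thesis
      proof cases
        case 1
        then have "N x b" using b(2) xy by auto
        then have "N y b" using Nco[of x b y] xy 1 yA by blast
        then show ?thesis using yK b by blast
      next
        case 2
        then show ?thesis using yK b by blast
      next
        case 3
        \<comment> \<open>Both sets contain \<open>y\<close>, since otherwise \<open>y\<close> would
          exclude itself. One of them lacks \<open>b\<close> although it contains everything above
          \<open>y\<close>, so \<open>y\<close> is above \<open>b\<close> in that order and the two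
          form a noninversion.\<close>
        have "y \<in> H i" "y \<in> H' i" using yK yA by blast+
        moreover have "\<And>u v. u \<in> A \<Longrightarrow> v \<in> H i \<Longrightarrow> R u v \<Longrightarrow> u \<in> H i"
          "\<And>u v. u \<in> A \<Longrightarrow> v \<in> H' i \<Longrightarrow> R' u v \<Longrightarrow> u \<in> H' i"
          using 1 2 i unfolding target_def by blast+
        ultimately have "\<not> R b y \<or> \<not> R' b y" using b by blast
        moreover have "R b y \<longleftrightarrow> \<not> R y b" "R' b y \<longleftrightarrow> \<not> R' y b"
          using 1 2 b(1) yA 3 unfolding target_def by (metis less_irrefl)+
        ultimately have "N b y" using Nstep b(1) yA 3 by blast
        then have "N x y" using b(2) Ntrans by blast
        then show ?thesis using xy by blast
      qed
    qed
  qed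
  have "K i \<subseteq> K j" if ij: "i < j" "j \<le> i + q i" "j < n" for i j
  proof
    fix a assume a: "a \<in> K i"
    have aA: "a \<in> A" using a KA by blast
    show "a \<in> K j"
    proof (rule ccontr)
      assume "a \<notin> K j"
      then obtain b i' where b: "b \<in> A" "a = b \<or> N a b" "b \<notin> H i' \<or> b \<notin> H' i'" "lies_left q i' j"
        using K aA by blast
      \<comment> \<open>Were \<open>i'\<close> at or before \<open>i\<close>, the interval of
        \<open>i\<close> would stop before \<open>j\<close>. So \<open>i'\<close> lies in the
        interval of \<open>i\<close> for both vectors, and a label missing at \<open>i'\<close> is
        already missing at \<open>i\<close>.\<close>
      have "\<not> i' \<le> i" using b(4) ij by (auto simp: lies_left_def)
      then have "i < i'" "i' \<le> i + r i" "i' \<le> i + r' i" "i' < n"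
        using b(4) ij by (auto simp: lies_left_def q_def)
      moreover have "compat n r (\<lambda>i j. H j \<subseteq> H i)" "compat n r' (\<lambda>i j. H' j \<subseteq> H' i)"
        using 1 2 unfolding target_def by blast+
      ultimately have "H i \<subseteq> H i'" "H' i \<subseteq> H' i'" unfolding compat_def by blast+
      then show False using K[OF aA, of i] a b lies_left_refl by blast
    qed
  qed
  moreover have "K j \<subseteq> K i" if "lies_left q i j" "j < n" for i j
  proof
    fix a assume a: "a \<in> K j"
    have aA: "a \<in> A" using a KA by blast
    show "a \<in> K i"
    proof (rule ccontr)
      assume "a \<notin> K i"
      then obtain b i' where b: "b \<in> A" "a = b \<or> N a b" "b \<notin> H i' \<or> b \<notin> H' i'" "lies_left q i' i"
        using K aA by blast
      have "lies_left q i' j" using lies_left_trans[OF brq b(4)] that by blast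
      then show False using K[OF aA, of j] a b by blast
    qed
  qed
  ultimately have "compat n q (\<lambda>i j. K j \<subseteq> K i)" by (simp add: compat_def)
  then have "target A n Q K q"
    unfolding target_def
  proof (intro conjI ballI allI impI)
    show "bracket n q" by (rule brq)
    show "\<And>x y. x \<noteq> y \<Longrightarrow> Q x y \<longleftrightarrow> \<not> Q y x" by (rule asym)
    show "\<And>x. \<not> Q x x" by (rule irr)
    show "\<And>i. K i \<subseteq> A" by (rule KA)
    show "\<And>x y z. x \<in> A \<Longrightarrow> y \<in> A \<Longrightarrow> z \<in> A \<Longrightarrow> Q x y \<Longrightarrow> Q y z \<Longrightarrow> Q x z"
      using tr by blast
    show "\<And>i x y. i < n \<Longrightarrow> x \<in> A \<Longrightarrow> y \<in> K i \<Longrightarrow> Q x y \<Longrightarrow> x \<in> K i" using up by blast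
  qed
  then show ?thesis by (simp add: Q_def K_def q_def[abs_def])
qed

lemma steps_iff_within:
  assumes "well_formed A n t w" "well_formed A n t' w'"
  shows "step\<^sup>*\<^sup>* (t, w) (t', w') \<longleftrightarrow> within n t w (precedes w') (above t' w') (reach t')"
proof
  assume "within n t w (precedes w') (above t' w') (reach t')"
  then obtain t1 w1 where s: "step\<^sup>*\<^sup>* (t, w) (t1, w1)"
    "attains A n t1 w1 (precedes w') (above t' w') (reach t')"
    using steps_towards[OF target_state] assms by blast
  then have "t1 = t' \<and> w1 = w'"
    using attains_unique[OF steps_well_formed[OF s(1) assms(1)] assms(2) s(2) attains_self] by blast
  then show "step\<^sup>*\<^sup>* (t, w) (t', w')" using s by simp
qed (rule steps_within[OF _ assms(1)])

text \<open>A tree dominated by both targets has a transitive word and compatible heights of its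
  own. Hence whatever the construction of the meet forces already holds in it.\<close>

lemma within_meet:
  assumes wf: "well_formed A n t w"
    and 1: "target A n R H r" "within n t w R H r" and 2: "target A n R' H' r'" "within n t w R' H' r'"
  shows "within n t w (meet_order A R R') (meet_above A R R' H H' (\<lambda>i. min (r i) (r' i)))
    (\<lambda>i. min (r i) (r' i))"
proof -
  have dw: "distinct w" "set w = A" using wf by (auto simp: well_formed_def)
  have one: "precedes w y x" if "x \<in> A" "y \<in> A" "x < y" "R y x \<or> R' y x" for x y
  proof -
    have "R x y \<longleftrightarrow> \<not> R y x" "R' x y \<longleftrightarrow> \<not> R' y x"
      using 1(1) 2(1) that(1-3) unfolding target_def by (metis less_irrefl)+
    then have "\<not> precedes w x y" using 1(2) 2(2) that(3,4) unfolding within_def by blast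
    then show ?thesis using precedes_total[of x w y] dw that by auto
  qed
  have under: "precedes w y x" if "meet_unders A R R' x y" for x y
    using that unfolding meet_unders_def
  proof (induction rule: tranclp_induct)
    case (base y)
    then show ?case using one by blast
  next
    case (step y z)
    then have "precedes w z y" using one by blast
    then show ?case using step.IH precedes_trans[OF dw(1)] by blast
  qed
  show ?thesis
    unfolding within_def
  proof (intro conjI allI impI)
    fix x y assume xy: "x < y" "precedes w x y"
    then have "\<not> precedes w y x" using precedes_asym[OF dw(1)] by blast
    then show "meet_order A R R' x y" using xy under unfolding meet_order_def by blast
  next
    fix i assume i: "i < n"
    show "reach t i \<le> min (r i) (r' i)" using 1(2) 2(2) i by (simp add: within_def)
    show "above t w i \<subseteq> meet_above A R R' H H' (\<lambda>i. min (r i) (r' i)) i"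
    proof
      fix a assume a: "a \<in> above t w i"
      have "a \<in> A" using a dw(2) by (auto simp: above_def dest: in_set_takeD)
      moreover have "b \<in> H j \<and> b \<in> H' j"
        if b: "a = b \<or> meet_unders A R R' a b" and l: "lies_left (\<lambda>i. min (r i) (r' i)) j i" for b j
      proof -
        have ji: "j \<le> i" using l by (simp add: lies_left_def)
        have "b \<in> above t w i"
          using b a under[of a b] precedes_take[OF dw(1)] by (auto simp: above_def)
        \<comment> \<open>Smaller reaches give more left descendants, so \<open>j\<close> is a left
          descendant of \<open>i\<close> in \<open>t\<close> too and has at least the same labels
          above it.\<close>
        moreover have "lies_left (reach t) j i"
          unfolding lies_left_def
        proof (intro conjI allI impI)
          fix k assume k: "j \<le> k \<and> k < i"
          then have "k + min (r k) (r' k) < i" using l by (simp add: lies_left_def)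
          moreover have "reach t k \<le> min (r k) (r' k)" using 1(2) 2(2) k i by (simp add: within_def)
          ultimately show "k + reach t k < i" by linarith
        qed (rule ji)
        then have "above t w i \<subseteq> above t w j"
          using target_state[OF wf] i unfolding target_def compat_def by blast
        ultimately have "b \<in> above t w j" by blast
        then show ?thesis using 1(2) 2(2) ji i unfolding within_def by (meson le_less_trans subsetD)
      qed
      ultimately show "a \<in> meet_above A R R' H H' (\<lambda>i. min (r i) (r' i)) i"
        unfolding meet_above_def by blast
    qed
  qed
qed

lemma meet_within:
  assumes 1: "target A n R H r" and 2: "target A n R' H' r'" and wf: "well_formed A n t w"
    and m: "attains A n t w (meet_order A R R') (meet_above A R R' H H' (\<lambda>i. min (r i) (r' i)))
    (\<lambda>i. min (r i) (r' i))"
  shows "within n t w R H r" "within n t w R' H' r'"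
proof -
  have "R x y \<and> R' x y" if xy: "x < y" "precedes w x y" for x y
  proof -
    have A: "x \<in> A" "y \<in> A" using precedes_in_set[OF xy(2)] wf by (auto simp: well_formed_def)
    have "meet_order A R R' x y" using m A xy unfolding attains_def by blast
    then have "\<not> meet_unders A R R' x y" using xy meet_undersD[of A R R' y x] unfolding meet_order_def by auto
    then have "\<not> R y x" "\<not> R' y x" using meet_unders_step A xy by metis+
    moreover have "R x y \<longleftrightarrow> \<not> R y x" "R' x y \<longleftrightarrow> \<not> R' y x"
      using 1 2 A xy(1) unfolding target_def by (metis less_irrefl)+
    ultimately show ?thesis by blast
  qed
  moreover have "above t w i \<subseteq> H i \<and> above t w i \<subseteq> H' i \<and> reach t i \<le> r i \<and> reach t i \<le> r' i" if "i < n" for i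
  proof -
    have "above t w i = meet_above A R R' H H' (\<lambda>i. min (r i) (r' i)) i" "reach t i = min (r i) (r' i)"
      using m that unfolding attains_def by blast+
    moreover have "meet_above A R R' H H' (\<lambda>i. min (r i) (r' i)) i \<subseteq> H i \<inter> H' i"
      unfolding meet_above_def using lies_left_refl by blast
    ultimately show ?thesis by auto
  qed
  ultimately show "within n t w R H r" "within n t w R' H' r'" unfolding within_def by blast+
qed

section \<open>Left combs and the existence of meets\<close>

definition stalk :: "nat \<Rightarrow> cut_tree" where
  "stalk k = (Cut ^^ k) Tip"

text \<open>No right subtree contains a fork and all cuts lie beneath all forks, so
  \<open>reach\<close> and \<open>cuts_under\<close> are both extreme. That this tree is the least
  one of its size is \<open>left_comb_least\<close>.\<close>

primrec left_comb :: "nat \<Rightarrow> nat \<Rightarrow> cut_tree" where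
  "left_comb 0 k = stalk k"
| "left_comb (Suc n) k = Fork (left_comb n k) (stalk k)"

lemma stalk_simps [simp]: "stalk 0 = Tip" "stalk (Suc k) = Cut (stalk k)"
  by (simp_all add: stalk_def)

lemma stalk_props [simp]: "forks (stalk k) = 0" "depth (stalk k) = k" "uniform (stalk k)"
  by (induction k) simp_all

lemma left_comb_props [simp]:
  "forks (left_comb n k) = n" "depth (left_comb n k) = k" "uniform (left_comb n k)"
  by (induction n) simp_all

lemma left_comb_data: "i < n \<Longrightarrow> reach (left_comb n k) i = 0 \<and> cuts_under (left_comb n k) i = k"
  by (induction n) auto

text \<open>Every target dominates the left comb whose labels decrease downward, so climbing from
  there realises the data of the meet.\<close>

lemma state_meet:
  assumes wf1: "well_formed A n t1 w1" and wf2: "well_formed A n t2 w2"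
  obtains t w where "well_formed A n t w" "step\<^sup>*\<^sup>* (t, w) (t1, w1)" "step\<^sup>*\<^sup>* (t, w) (t2, w2)"
    "\<And>t' w'. well_formed A n t' w' \<Longrightarrow> step\<^sup>*\<^sup>* (t', w') (t1, w1) \<Longrightarrow> step\<^sup>*\<^sup>* (t', w') (t2, w2) \<Longrightarrow>
      step\<^sup>*\<^sup>* (t', w') (t, w)"
proof -
  define w0 where "w0 = rev (sorted_list_of_set A)"
  define t0 where "t0 = left_comb n (length w0)"
  define r where "r = (\<lambda>i. min (reach t1 i) (reach t2 i))"
  define R where "R = meet_order A (precedes w1) (precedes w2)"
  define H where "H = meet_above A (precedes w1) (precedes w2) (above t1 w1) (above t2 w2) r"
  note tgt1 = target_state[OF wf1] and tgt2 = target_state[OF wf2]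
  have tgt: "target A n R H r" using target_meet[OF tgt1 tgt2] by (simp add: R_def H_def r_def[abs_def])
  have "finite A" using wf1 by (auto simp: well_formed_def)
  then have wf0: "well_formed A n t0 w0" by (simp add: well_formed_def t0_def w0_def)
  have "sorted_wrt (\<ge>) w0" by (simp add: w0_def sorted_wrt_rev)
  then have "\<not> precedes w0 x y" if "x < y" for x y using that
    unfolding sorted_wrt_precedes by (meson linorder_not_le)
  then have "within n t0 w0 R H r"
    using left_comb_data[of _ n "length w0"] by (simp add: within_def above_def t0_def)
  then obtain t w where tw: "step\<^sup>*\<^sup>* (t0, w0) (t, w)" "attains A n t w R H r"
    using steps_towards[OF tgt wf0] by blast
  have wf: "well_formed A n t w" using tw(1) wf0 by (rule steps_well_formed)
  have w: "within n t w (precedes w1) (above t1 w1) (reach t1)"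
    "within n t w (precedes w2) (above t2 w2) (reach t2)"
    using meet_within[OF tgt1 tgt2 wf] tw(2) unfolding R_def H_def r_def by blast+
  show ?thesis
  proof (rule that[OF wf])
    show "step\<^sup>*\<^sup>* (t, w) (t1, w1)" "step\<^sup>*\<^sup>* (t, w) (t2, w2)"
      using w steps_iff_within wf wf1 wf2 by blast+
    fix t' w' assume wf': "well_formed A n t' w'"
      and s: "step\<^sup>*\<^sup>* (t', w') (t1, w1)" "step\<^sup>*\<^sup>* (t', w') (t2, w2)"
    have "within n t' w' R H r"
      unfolding R_def H_def r_def
      by (rule within_meet[OF wf' tgt1 steps_within[OF s(1) wf'] tgt2 steps_within[OF s(2) wf']])
    then obtain t3 w3 where "step\<^sup>*\<^sup>* (t', w') (t3, w3)" "attains A n t3 w3 R H r"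
      using steps_towards[OF tgt wf'] by blast
    then show "step\<^sup>*\<^sup>* (t', w') (t, w)"
      using attains_unique[OF _ wf _ tw(2)] steps_well_formed[OF _ wf'] by blast
  qed
qed

section \<open>The shadow map and its left adjoint\<close>

text \<open>Only the right child is followed. A left subtree leaves behind its number of leaves, one
  more than its number of forks, as the sole entry of a tuple.\<close>

fun shade_of :: "cut_tree \<Rightarrow> nat list \<Rightarrow> shade" where
  "shade_of Tip w = []"
| "shade_of (Cut t) w = ([], {hd w}) # shade_of t (tl w)"
| "shade_of (Fork l r) w = ([Suc (forks l)], {}) # shade_of r w"

text \<open>A left subtree with \<open>r\<close> leaves has \<open>r - 1\<close> forks. Its comb
  carries as many cuts as there are further down the right branch, which keeps the tree uniform. For
  tuples of a unary shade, \<open>s\<close> and \<open>c\<close> are empty.\<close>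

fun grow :: "shade \<Rightarrow> cut_tree" where
  "grow [] = Tip"
| "grow (([], c) # S) = Cut (grow S)"
| "grow ((r # s, c) # S) = Fork (left_comb (r - 1) (depth (grow S))) (grow S)"

fun lights :: "shade \<Rightarrow> nat list" where
  "lights [] = []"
| "lights (([], c) # S) = the_elem c # lights S"
| "lights ((r # s, c) # S) = lights S"

definition unary_entry :: "nat list \<times> nat set \<Rightarrow> bool" where
  "unary_entry x \<longleftrightarrow> (\<exists>a. x = ([], {a})) \<or> (\<exists>r>0. x = ([r], {}))"

definition proper_shade :: "nat set \<Rightarrow> nat \<Rightarrow> shade \<Rightarrow> bool" where
  "proper_shade A n S \<longleftrightarrow> (\<forall>x\<in>set S. unary_entry x) \<and> sum_list (map (\<lambda>x. sum_list (fst x)) S) = n \<and>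
     distinct (lights S) \<and> set (lights S) = A"

lemma unary_entry_cases:
  assumes "unary_entry x"
  obtains a where "x = ([], {a})" | r where "x = ([Suc r], {})"
  using assms unfolding unary_entry_def by (metis Suc_pred)

lemma unary_entry_simps [simp]: "unary_entry ([], {a})" "unary_entry ([Suc r], {})"
  "unary_entry ([r], {}) \<longleftrightarrow> 0 < r"
  by (auto simp: unary_entry_def)

lemma shade_induct [consumes 1, case_names Nil cut tuple]:
  assumes "\<forall>x\<in>set S. unary_entry x"
    and "P []" "\<And>a S. \<forall>x\<in>set S. unary_entry x \<Longrightarrow> P S \<Longrightarrow> P (([], {a}) # S)"
    and "\<And>r S. \<forall>x\<in>set S. unary_entry x \<Longrightarrow> P S \<Longrightarrow> P (([Suc r], {}) # S)"
  shows "P S"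
  using assms(1)
proof (induction S)
  case (Cons x S)
  then show ?case using assms(3,4) by (auto elim!: unary_entry_cases)
qed (rule assms(2))

lemma grow_props:
  assumes "\<forall>x\<in>set S. unary_entry x"
  shows "uniform (grow S)" "depth (grow S) = length (lights S)"
    "forks (grow S) = sum_list (map (\<lambda>x. sum_list (fst x)) S)"
    "shade_of (grow S) (lights S) = S"
  using assms by (induction rule: shade_induct) auto

lemma well_formed_grow: "proper_shade A n S \<Longrightarrow> well_formed A n (grow S) (lights S)"
  using grow_props[of S] by (simp add: proper_shade_def well_formed_def)

lemma shade_of_props:
  assumes "uniform t" "depth t = length w"
  shows "\<forall>x\<in>set (shade_of t w). unary_entry x" "lights (shade_of t w) = w"
    "sum_list (map (\<lambda>x. sum_list (fst x)) (shade_of t w)) = forks t"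
  using assms
proof (induction t w rule: shade_of.induct)
  case (2 t w)
  { case 1 then show ?case using 2 by simp }
  { case 2 then show ?case using "2.IH" by (cases w) simp_all }
  { case 3 then show ?case using "2.IH" by simp }
qed auto

lemma proper_shade_of: "well_formed A n t w \<Longrightarrow> proper_shade A n (shade_of t w)"
  using shade_of_props[of t w] by (simp add: proper_shade_def well_formed_def)

lemma shade_move_Cons: "shade_move S S' \<Longrightarrow> shade_move (x # S) (x # S')"
proof (induction rule: shade_move.induct)
  case (split_tuple s t X Y)
  then show ?case using shade_move.split_tuple[of s t "x # X" Y] by simp
next
  case (raise_cut X r a Y)
  then show ?case using shade_move.raise_cut[of "x # X" r a Y] by simp
next
  case (exchange_labels a b X Y)
  then show ?case using shade_move.exchange_labels[of a b "x # X" Y] by simp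
qed

text \<open>Inside a left subtree a rotation keeps the number of leaves, so the shade does not
  change. On the right branch, rotating the edge to a left child splits a tuple, and raising a cut
  moves it past a tuple.\<close>

lemma shade_of_rot:
  assumes "rot t t'" "uniform t" "depth t = length w"
  shows "shade_of t' w = shade_of t w \<or> shade_move (shade_of t w) (shade_of t' w)"
  using assms
proof (induction arbitrary: w rule: rot.induct)
  case (rot_edge a b c)
  then show ?case
    using shade_move.split_tuple[of "Suc (forks a)" "Suc (forks b)" "[]" "shade_of c w"] by simp
next
  case (rot_raise a b)
  then show ?case
    using shade_move.raise_cut[of "[]" "Suc (forks a)" "hd w" "shade_of b (tl w)"] by simp
next
  case (rot_Cut t t')
  then have "uniform t" "depth t = length (tl w)" by (cases w; simp)+
  then show ?case using rot_Cut.IH[of "tl w"] by (auto intro: shade_move_Cons)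
next
  case (rot_left t t' u)
  then show ?case by (simp add: rot_forks)
next
  case (rot_right t t' u)
  then show ?case using rot_right.IH[of w] by (auto intro: shade_move_Cons)
qed

text \<open>A node of the right branch between the two cuts would violate the side condition, so the
  two cuts are neighbours in the shade as well.\<close>

lemma shade_of_exchange:
  assumes "a < b" "uniform t" "depth t = length (u @ b # a # v)"
    and "\<forall>i<forks t. cuts_under t i \<noteq> Suc (length v)"
  shows "shade_move (shade_of t (u @ b # a # v)) (shade_of t (u @ a # b # v))"
  using assms(2-)
proof (induction t arbitrary: u)
  case (Cut t)
  show ?case
  proof (cases u)
    case Nil
    then have d: "depth t = Suc (length v)" using Cut.prems by simp
    show ?thesis
    proof (cases t)
      case (Fork l r)
      then show ?thesis using d Cut.prems(3)[rule_format, of "forks l"] by simp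
    qed (use d Nil shade_move.exchange_labels[OF assms(1), of "[]"] in auto)
  next
    case (Cons x u')
    then show ?thesis using Cut by (auto intro: shade_move_Cons)
  qed
next
  case (Fork l r)
  have "cuts_under r i \<noteq> Suc (length v)" if "i < forks r" for i
    using Fork.prems(3)[rule_format, of "Suc (forks l + i)"] that by simp
  then show ?case using Fork by (auto intro: shade_move_Cons)
qed simp

lemma shade_of_step:
  assumes "step (t, w) (t', w')" "well_formed A n t w"
  shows "shade_of t' w' = shade_of t w \<or> shade_move (shade_of t w) (shade_of t' w')"
  using assms(1)
proof cases
  case step_rot
  then show ?thesis using shade_of_rot assms(2) by (simp add: well_formed_def)
next
  case (step_exchange a b v u)
  then show ?thesis using shade_of_exchange assms(2) by (simp add: well_formed_def)
qed

section \<open>Climbing from left combs, and monotonicity of the left adjoint\<close>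

lemma rots_Cut: "rot\<^sup>*\<^sup>* t t' \<Longrightarrow> rot\<^sup>*\<^sup>* (Cut t) (Cut t')"
  by (induction rule: rtranclp_induct) (auto intro: rtranclp.rtrancl_into_rtrancl rot_Cut)

lemma rots_left: "rot\<^sup>*\<^sup>* t t' \<Longrightarrow> rot\<^sup>*\<^sup>* (Fork t u) (Fork t' u)"
  by (induction rule: rtranclp_induct) (auto intro: rtranclp.rtrancl_into_rtrancl rot_left)

lemma rots_right: "rot\<^sup>*\<^sup>* t t' \<Longrightarrow> rot\<^sup>*\<^sup>* (Fork u t) (Fork u t')"
  by (induction rule: rtranclp_induct) (auto intro: rtranclp.rtrancl_into_rtrancl rot_right)

text \<open>The top cut climbs past the forks of the comb one at a time, the deepest first.\<close>

lemma left_comb_raise: "rot\<^sup>*\<^sup>* (left_comb n (Suc k)) (Cut (left_comb n k))"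
proof (induction n)
  case (Suc n)
  then have "rot\<^sup>*\<^sup>* (left_comb (Suc n) (Suc k)) (Fork (Cut (left_comb n k)) (Cut (stalk k)))"
    using rots_left by simp
  then show ?case by (auto intro: rtranclp.rtrancl_into_rtrancl rot_raise)
qed simp

text \<open>The \<open>b\<close> uppermost forks are rotated into the right subtree of the fork
  beneath them, the lowest of them first.\<close>

lemma left_comb_split: "rot\<^sup>*\<^sup>* (left_comb (Suc (a + b)) k) (Fork (left_comb a k) (left_comb b k))"
proof (induction b)
  case (Suc b)
  have "rot\<^sup>*\<^sup>* (left_comb (Suc (a + Suc b)) k) (Fork (Fork (left_comb a k) (left_comb b k)) (stalk k))"
    using rots_left[OF Suc] by simp
  then show ?case by (auto intro: rtranclp.rtrancl_into_rtrancl rot_edge)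
qed simp

text \<open>Following the shape of \<open>t\<close>, the comb is split at a fork and its top cut is
  raised at a cut; smaller combs remain.\<close>

lemma left_comb_least: "uniform t \<Longrightarrow> rot\<^sup>*\<^sup>* (left_comb (forks t) (depth t)) t"
proof (induction t)
  case (Cut t)
  then have "rot\<^sup>*\<^sup>* (Cut (left_comb (forks t) (depth t))) (Cut t)" by (simp add: rots_Cut)
  then show ?case using left_comb_raise[of "forks t" "depth t"] by (simp add: rtranclp_trans)
next
  case (Fork l r)
  then have "rot\<^sup>*\<^sup>* (Fork (left_comb (forks l) (depth l)) (left_comb (forks r) (depth l))) (Fork l r)"
    using rots_left[of _ l "left_comb (forks r) (depth l)"] rots_right[of _ r l] 
    by (auto intro: rtranclp_trans)
  then show ?case using left_comb_split[of "forks l" "forks r" "depth l"]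
    by (simp del: left_comb.simps add: rtranclp_trans)
qed simp

text \<open>Growing the shade of \<open>t\<close> replaces every left subtree off the right branch
  by the comb of the same size, which is least by \<open>left_comb_least\<close>.\<close>

lemma grow_shade_of:
  "uniform t \<Longrightarrow> depth t = length w \<Longrightarrow> rot\<^sup>*\<^sup>* (grow (shade_of t w)) t"
proof (induction t w rule: shade_of.induct)
  case (2 t w)
  then show ?case by (simp add: rots_Cut)
next
  case (3 l r w)
  have "depth (grow (shade_of r w)) = depth l" using grow_props(2) shade_of_props[of r w] 3 by simp
  moreover have "rot\<^sup>*\<^sup>* (Fork (left_comb (forks l) (depth l)) r) (Fork l r)"
    using left_comb_least[of l] 3 by (simp add: rots_left)
  ultimately show ?case using 3 rots_right by (auto intro: rtranclp_trans)
qed simp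

text \<open>The combs added for \<open>X\<close> depend on the rest only through its depth, which
  rotations preserve.\<close>

lemma grow_rots_prefix:
  assumes "rot\<^sup>*\<^sup>* (grow S) (grow S')" "\<forall>x\<in>set X. unary_entry x"
  shows "rot\<^sup>*\<^sup>* (grow (X @ S)) (grow (X @ S'))"
proof -
  have depth: "depth t' = depth t" if "rot\<^sup>*\<^sup>* t t'" for t t'
    using that by (induction rule: rtranclp_induct) (auto simp: rot_depth)
  from assms(2) show ?thesis
  proof (induction rule: shade_induct)
    case (tuple r X)
    then show ?case using depth[OF tuple.IH] by (simp add: rots_right)
  qed (use assms(1) in \<open>simp_all add: rots_Cut\<close>)
qed

lemma lights_append: "\<forall>x\<in>set X. unary_entry x \<Longrightarrow> lights (X @ S) = lights X @ lights S"
  by (induction rule: shade_induct) auto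

text \<open>A split or a raised cut is prepared inside the comb before it takes place at the node of
  the right branch. An exchange of labels leaves the tree as it is.\<close>

lemma grow_move:
  assumes "shade_move S S'" "proper_shade A n S"
  shows "step\<^sup>*\<^sup>* (grow S, lights S) (grow S', lights S')"
  using assms
proof cases
  case (split_tuple s t X Y)
  define k where "k = depth (grow Y)"
  have unary: "\<forall>x\<in>set X. unary_entry x" using assms(2) split_tuple by (simp add: proper_shade_def)
  obtain a b where ab: "s = Suc a" "t = Suc b" using split_tuple by (metis Suc_le_D One_nat_def)
  have "rot\<^sup>*\<^sup>* (Fork (left_comb (Suc (a + b)) k) (grow Y)) (Fork (Fork (left_comb a k) (left_comb b k)) (grow Y))"
    by (rule rots_left[OF left_comb_split])
  then have "rot\<^sup>*\<^sup>* (grow (([s + t], {}) # Y)) (grow (([s], {}) # ([t], {}) # Y))"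
    using ab by (auto simp: k_def intro: rtranclp.rtrancl_into_rtrancl rot_edge)
  then have "rot\<^sup>*\<^sup>* (grow S) (grow S')"
    using grow_rots_prefix unary split_tuple by metis
  moreover have "lights S' = lights S" using unary split_tuple by (simp add: lights_append)
  ultimately show ?thesis using step_rots by simp
next
  case (raise_cut X r a Y)
  define k where "k = depth (grow Y)"
  have unary: "\<forall>x\<in>set X. unary_entry x" using assms(2) raise_cut by (simp add: proper_shade_def)
  have "rot\<^sup>*\<^sup>* (Fork (left_comb (r - 1) (Suc k)) (Cut (grow Y))) (Fork (Cut (left_comb (r - 1) k)) (Cut (grow Y)))"
    by (rule rots_left[OF left_comb_raise])
  then have "rot\<^sup>*\<^sup>* (grow (([r], {}) # ([], {a}) # Y)) (grow (([], {a}) # ([r], {}) # Y))"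
    by (auto simp: k_def intro: rtranclp.rtrancl_into_rtrancl rot_raise)
  then have "rot\<^sup>*\<^sup>* (grow S) (grow S')"
    using grow_rots_prefix unary raise_cut by metis
  moreover have "lights S' = lights S" using unary raise_cut by (simp add: lights_append)
  ultimately show ?thesis using step_rots by simp
next
  case (exchange_labels a b X Y)
  have unary: "\<forall>x\<in>set X. unary_entry x" "\<forall>x\<in>set Y. unary_entry x"
    using assms(2) exchange_labels by (simp_all add: proper_shade_def)
  define k where "k = length (lights Y)"
  have Y: "uniform (grow Y)" "depth (grow Y) = k" using grow_props unary by (simp_all add: k_def)
  \<comment> \<open>A node grown from \<open>X\<close> has all later cuts beneath it, at least
    \<open>k + 2\<close> of them, since combs carry their cuts at the bottom; a node grown from
    \<open>Y\<close> has at most \<open>k\<close>. So the forbidden value \<open>Suc k\<close> does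
    not occur.\<close>
  have "grow (X @ ([], {b}) # ([], {a}) # Y) = grow (X @ ([], {a}) # ([], {b}) # Y) \<and>
    k + 2 \<le> depth (grow (X @ ([], {b}) # ([], {a}) # Y)) \<and>
    (\<forall>i<forks (grow (X @ ([], {b}) # ([], {a}) # Y)). 
      cuts_under (grow (X @ ([], {b}) # ([], {a}) # Y)) i \<noteq> Suc k)"
    using unary(1)
  proof (induction rule: shade_induct)
    case Nil
    then show ?case using Y cuts_under_le[of "grow Y"] by fastforce
  next
    case (cut x X)
    then show ?case by (elim conjE) simp
  next
    case (tuple r X)
    let ?t = "grow (X @ ([], {b}) # ([], {a}) # Y)"
    have "cuts_under (Fork (left_comb r (depth ?t)) ?t) i \<noteq> Suc k"
      if "i < forks (Fork (left_comb r (depth ?t)) ?t)" for i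
      using that
    proof (cases rule: fork_cases)
      case 1
      have "k + 2 \<le> depth ?t" using tuple.IH by blast
      then show ?thesis using 1 left_comb_data[of i r "depth ?t"] by simp
    qed (use tuple.IH in auto)
    then show ?case
      using conjunct1[OF tuple.IH] conjunct1[OF conjunct2[OF tuple.IH]] by simp
  qed
  then show ?thesis
    using exchange_labels unary step_exchange[of a b "grow S" "lights Y" "lights X"]
    by (auto simp: lights_append k_def)
qed

section \<open>Painted trees as trees with cuts\<close>

lemma nodes_simps [simp]:
  "nodes Leaf = {}"
  "[] \<in> nodes (Node x ts)"
  "i # p \<in> nodes (Node x ts) \<longleftrightarrow> i < length ts \<and> p \<in> nodes (ts ! i)"
  by (auto simp: nodes_def elim: subtree_at.elims)

lemma leaf_addresses_simps [simp]:
  "leaf_addresses Leaf = {[]}"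
  "[] \<notin> leaf_addresses (Node x ts)"
  "i # p \<in> leaf_addresses (Node x ts) \<longleftrightarrow> i < length ts \<and> p \<in> leaf_addresses (ts ! i)"
  by (auto simp: leaf_addresses_def elim: subtree_at.elims)

lemma ball_leaf_addresses:
  "(\<forall>q\<in>leaf_addresses (Node x ts). P q) \<longleftrightarrow>
    (\<forall>i<length ts. \<forall>q\<in>leaf_addresses (ts ! i). P (i # q))"
proof
  assume "\<forall>q\<in>leaf_addresses (Node x ts). P q"
  then show "\<forall>i<length ts. \<forall>q\<in>leaf_addresses (ts ! i). P (i # q)" by simp
next
  assume r: "\<forall>i<length ts. \<forall>q\<in>leaf_addresses (ts ! i). P (i # q)"
  show "\<forall>q\<in>leaf_addresses (Node x ts). P q"
  proof
    fix q assume "q \<in> leaf_addresses (Node x ts)"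
    then show "P q" using r by (cases q) simp_all
  qed
qed

lemma children_simps [simp]:
  "children (Node x ts) [] = ts"
  "i < length ts \<Longrightarrow> children (Node x ts) (i # p) = children (ts ! i) p"
  by (auto simp: children_def)

lemma arity_simps [simp]:
  "arity (Node x ts) [] = length ts"
  "i < length ts \<Longrightarrow> arity (Node x ts) (i # p) = arity (ts ! i) p"
  by (auto simp: arity_def)

section \<open>Restricting cuts to the subtrees of the root\<close>

definition branch :: "nat \<Rightarrow> address set \<Rightarrow> address set" where
  "branch i c = {p. i # p \<in> c}"

lemma in_branch [simp]: "p \<in> branch i c \<longleftrightarrow> i # p \<in> c"
  by (simp add: branch_def)

lemma image_Cons_simps [simp]:
  "[] \<notin> (#) i ` c" "i # p \<in> (#) j ` c \<longleftrightarrow> i = j \<and> p \<in> c"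
  by auto

lemma branch_decompose:
  assumes "[] \<notin> c" "\<forall>i p. i # p \<in> c \<longrightarrow> i \<in> I"
  shows "c = (\<Union>i\<in>I. (#) i ` branch i c)"
proof (intro equalityI subsetI)
  fix p assume "p \<in> c"
  then show "p \<in> (\<Union>i\<in>I. (#) i ` branch i c)" using assms by (cases p) auto
qed auto

lemma is_cut_Node:
  assumes "[] \<notin> c"
  shows "is_cut (Node x ts) c \<longleftrightarrow>
    (\<forall>i p. i # p \<in> c \<longrightarrow> i < length ts) \<and> (\<forall>i<length ts. is_cut (ts ! i) (branch i c))"
proof -
  have sub: "c \<subseteq> nodes (Node x ts) \<longleftrightarrow>
    (\<forall>i p. i # p \<in> c \<longrightarrow> i < length ts) \<and> (\<forall>i<length ts. branch i c \<subseteq> nodes (ts ! i))"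
  proof (intro iffI conjI allI impI)
    fix i p assume "c \<subseteq> nodes (Node x ts)" "i # p \<in> c"
    then have "i # p \<in> nodes (Node x ts)" by blast
    then show "i < length ts" by simp
  next
    fix i assume c: "c \<subseteq> nodes (Node x ts)" "i < length ts"
    show "branch i c \<subseteq> nodes (ts ! i)"
    proof
      fix p assume "p \<in> branch i c"
      then have "i # p \<in> nodes (Node x ts)" using c by auto
      then show "p \<in> nodes (ts ! i)" by simp
    qed
  next
    assume r: "(\<forall>i p. i # p \<in> c \<longrightarrow> i < length ts) \<and> (\<forall>i<length ts. branch i c \<subseteq> nodes (ts ! i))"
    show "c \<subseteq> nodes (Node x ts)"
    proof
      fix p assume p: "p \<in> c"
      show "p \<in> nodes (Node x ts)"
      proof (cases p)
        case (Cons i p')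
        then have "i < length ts" "p' \<in> branch i c" using p r by auto
        then have "p' \<in> nodes (ts ! i)" using r by blast
        then show ?thesis using \<open>i < length ts\<close> Cons by simp
      qed simp
    qed
  qed
  have "(\<exists>!p. p \<in> c \<and> prefix p (i # q)) \<longleftrightarrow> (\<exists>!p. p \<in> branch i c \<and> prefix p q)" for i q
  proof
    assume "\<exists>!p. p \<in> c \<and> prefix p (i # q)"
    then obtain p where p: "p \<in> c" "prefix p (i # q)" "\<And>p'. p' \<in> c \<Longrightarrow> prefix p' (i # q) \<Longrightarrow> p' = p"
      by blast
    obtain p0 where p0: "p = i # p0" "prefix p0 q" using assms p(1,2) by (cases p) auto
    show "\<exists>!p. p \<in> branch i c \<and> prefix p q" 
    proof (rule ex1I[of _ p0])
      fix p' assume "p' \<in> branch i c \<and> prefix p' q"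
      then have "i # p' \<in> c" "prefix (i # p') (i # q)" by simp_all
      from p(3)[OF this] show "p' = p0" unfolding p0(1) by simp
    qed (use p(1) p0 in simp)
  next
    assume "\<exists>!p. p \<in> branch i c \<and> prefix p q"
    then obtain p where p: "i # p \<in> c" "prefix p q" "\<And>p'. i # p' \<in> c \<Longrightarrow> prefix p' q \<Longrightarrow> p' = p"
      unfolding in_branch by blast
    show "\<exists>!p. p \<in> c \<and> prefix p (i # q)"
    proof (rule ex1I[of _ "i # p"])
      fix p' assume "p' \<in> c \<and> prefix p' (i # q)"
      then show "p' = i # p" using p(3) assms by (metis Cons_prefix_Cons list.exhaust)
    qed (use p(1,2) in simp)
  qed
  then have leaves: "(\<forall>q\<in>leaf_addresses (Node x ts). \<exists>!p. p \<in> c \<and> prefix p q) \<longleftrightarrow>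
    (\<forall>i<length ts. \<forall>q\<in>leaf_addresses (ts ! i). \<exists>!p. p \<in> branch i c \<and> prefix p q)"
    unfolding ball_leaf_addresses by simp
  show ?thesis unfolding is_cut_def sub leaves by blast
qed

lemma is_cut_root: "is_cut (Node x ts) {[]}"
  by (auto simp: is_cut_def)

lemma below_Node:
  assumes "[] \<notin> c" "[] \<notin> c'"
  shows "below (Node x ts) c c' \<longleftrightarrow> (\<forall>i<length ts. below (ts ! i) (branch i c) (branch i c'))"
proof
  assume b: "below (Node x ts) c c'"
  show "\<forall>i<length ts. below (ts ! i) (branch i c) (branch i c')"
    unfolding below_def
  proof (intro allI impI ballI)
    fix i q p p' assume "i < length ts" "q \<in> leaf_addresses (ts ! i)" "p \<in> branch i c" "p' \<in> branch i c'"
      "prefix p q \<and> prefix p' q"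
    then have "strict_prefix (i # p') (i # p)"
      using b[unfolded below_def, rule_format, of "i # q" "i # p" "i # p'"] by simp
    then show "strict_prefix p' p" by simp
  qed
next
  assume b: "\<forall>i<length ts. below (ts ! i) (branch i c) (branch i c')"
  show "below (Node x ts) c c'"
    unfolding below_def
  proof (intro ballI impI)
    fix q p p' assume a: "q \<in> leaf_addresses (Node x ts)" "p \<in> c" "p' \<in> c'" "prefix p q \<and> prefix p' q"
    obtain i q0 where q: "q = i # q0" "i < length ts" "q0 \<in> leaf_addresses (ts ! i)"
      using a(1) by (cases q) auto
    obtain p0 where p: "p = i # p0" "prefix p0 q0" using a assms q by (cases p) auto
    obtain p0' where p': "p' = i # p0'" "prefix p0' q0" using a assms q by (cases p') auto
    have "strict_prefix p0' p0" using b a p p' q unfolding below_def by auto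
    then show "strict_prefix p' p" using p p' by simp
  qed
qed

text \<open>Being a cut and \<open>below\<close> are conditions along paths to leaves; positive
  arities put every node on such a path, so that these conditions reach all nodes.\<close>

lemma node_above_leaf:
  assumes "\<forall>p\<in>nodes T. arity T p \<ge> 1" "p \<in> nodes T"
  shows "\<exists>q\<in>leaf_addresses T. prefix p q"
proof -
  have ex: "\<exists>q. q \<in> leaf_addresses T" if "\<forall>p\<in>nodes T. arity T p \<ge> 1" for T :: "'b tree"
    using that
  proof (induction T)
    case (Node x ts)
    have "1 \<le> arity (Node x ts) []" using bspec[OF Node.prems nodes_simps(2)] .
    then have "ts \<noteq> []" by auto
    then obtain t ts' where ts: "ts = t # ts'" by (meson list.exhaust)
    have "\<forall>p\<in>nodes t. arity t p \<ge> 1"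
    proof
      fix p assume "p \<in> nodes t"
      then show "arity t p \<ge> 1" using Node.prems[rule_format, of "0 # p"] ts by simp
    qed
    then obtain q where "q \<in> leaf_addresses t" using Node.IH ts by auto
    then have "0 # q \<in> leaf_addresses (Node x ts)" using ts by simp
    then show ?case by blast
  qed auto
  show ?thesis
    using assms
  proof (induction p arbitrary: T)
    case Nil
    then show ?case using ex by auto
  next
    case (Cons i p)
    then obtain x ts where T: "T = Node x ts" by (cases T) auto
    then have i: "i < length ts" "p \<in> nodes (ts ! i)" using Cons by auto
    have "\<forall>p\<in>nodes (ts ! i). arity (ts ! i) p \<ge> 1"
    proof
      fix p assume "p \<in> nodes (ts ! i)"
      then show "arity (ts ! i) p \<ge> 1" using Cons.prems(1)[rule_format, of "i # p"] T i by simp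
    qed
    then obtain q where "q \<in> leaf_addresses (ts ! i)" "prefix p q" using Cons.IH i by blast
    then show ?case using T i by (intro bexI[of _ "i # q"]) auto
  qed
qed

section \<open>From trees with cuts to painted trees and back\<close>

fun decorate :: "cut_tree \<Rightarrow> nat set tree" where
  "decorate Tip = Leaf"
| "decorate (Cut t) = Node {depth t} [decorate t]"
| "decorate (Fork l r) = Node {} [decorate l, decorate r]"

fun plain :: "cut_tree \<Rightarrow> unit tree" where
  "plain Tip = Leaf"
| "plain (Cut t) = Node () [plain t]"
| "plain (Fork l r) = Node () [plain l, plain r]"

text \<open>Painted trees list their cuts from the lowest one, starting at 0, so the index of a cut
  is the number of cuts beneath it.\<close>

fun cutset :: "cut_tree \<Rightarrow> nat \<Rightarrow> address set" where
  "cutset Tip i = {}"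
| "cutset (Cut t) i = (if i = depth t then {[]} else (#) 0 ` cutset t i)"
| "cutset (Fork l r) i = (#) 0 ` cutset l i \<union> (#) 1 ` cutset r i"

definition cuts :: "cut_tree \<Rightarrow> address set list" where
  "cuts t = map (cutset t) [0..<depth t]"

lemma cutset_depth: "uniform t \<Longrightarrow> p \<in> cutset t i \<Longrightarrow> i < depth t"
  by (induction t arbitrary: p) (auto split: if_splits simp: less_Suc_eq)

lemma cut_indices_cuts: "uniform t \<Longrightarrow> cut_indices (cuts t) p = {i. p \<in> cutset t i}"
  by (auto simp: cut_indices_def cuts_def dest: cutset_depth)

text \<open>These are conditions on a binary painted tree free of labels and sizes; in this form
  they pass to the subtrees of the root, as the induction in \<open>plain_binary_cuts\<close>
  requires.\<close>

definition binary_cuts :: "unit tree \<Rightarrow> address set list \<Rightarrow> bool" where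
  "binary_cuts T C \<longleftrightarrow> (\<forall>p\<in>nodes T. arity T p \<ge> 1) \<and> (\<forall>c\<in>set C. is_cut T c) \<and>
     (\<forall>i. Suc i < length C \<longrightarrow> below T (C ! i) (C ! Suc i)) \<and>
     (\<forall>p\<in>\<Union> (set C). arity T p = 1) \<and> (\<forall>p\<in>nodes T - \<Union> (set C). arity T p = 2)"

lemma cutset_nodes: "p \<in> cutset t i \<Longrightarrow> p \<in> nodes (plain t) \<and> arity (plain t) p = 1"
  by (induction t arbitrary: p) (auto split: if_splits)

lemma arity_plain: "p \<in> nodes (plain t) \<Longrightarrow> uniform t \<Longrightarrow> \<forall>i<depth t. p \<notin> cutset t i \<Longrightarrow> arity (plain t) p = 2"
proof (induction t arbitrary: p)
  case (Cut t)
  then obtain p' where p: "p = 0 # p'" "p' \<in> nodes (plain t)"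
    by (cases p) (auto simp: less_Suc_eq)
  have "p' \<notin> cutset t i" if "i < depth t" for i
    using Cut.prems(3)[rule_format, of i] p that by auto
  then show ?case using Cut p by auto
next
  case (Fork l r)
  show ?case
  proof (cases p)
    case (Cons i p')
    then consider "i = 0" "p' \<in> nodes (plain l)" | "i = 1" "p' \<in> nodes (plain r)"
      using Fork.prems(1) by (auto simp: less_Suc_eq)
    then show ?thesis using Fork Cons by cases auto
  qed simp
qed simp

lemma arity_plain_ge: "p \<in> nodes (plain t) \<Longrightarrow> arity (plain t) p \<ge> 1"
proof (induction t arbitrary: p)
  case (Cut t)
  then show ?case by (cases p) auto
next
  case (Fork l r)
  then show ?case by (cases p) (auto simp: less_Suc_eq)
qed simp

lemma branch_simps [simp]:
  "branch i ((#) i ` c) = c" "i \<noteq> j \<Longrightarrow> branch i ((#) j ` c) = {}"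
  "branch i (c \<union> d) = branch i c \<union> branch i d"
  by (auto simp: branch_def)

lemma is_cut_cutset: "uniform t \<Longrightarrow> i < depth t \<Longrightarrow> is_cut (plain t) (cutset t i)"
proof (induction t)
  case (Cut t)
  then show ?case by (auto simp: is_cut_root is_cut_Node)
next
  case (Fork l r)
  then show ?case by (auto simp: is_cut_Node less_Suc_eq)
qed simp

lemma below_cutset: "uniform t \<Longrightarrow> i < j \<Longrightarrow> j < depth t \<Longrightarrow> below (plain t) (cutset t i) (cutset t j)"
proof (induction t)
  case (Cut t)
  show ?case
  proof (cases "j = depth t")
    case True
    then show ?thesis using Cut.prems by (auto simp: below_def)
  next
    case False
    then show ?thesis using Cut by (auto simp: below_Node)
  qed
next
  case (Fork l r)
  then show ?case by (auto simp: below_Node less_Suc_eq)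
qed simp

lemma binary_cuts_plain: "uniform t \<Longrightarrow> binary_cuts (plain t) (cuts t)"
  unfolding binary_cuts_def
  by (auto simp: cuts_def arity_plain_ge[unfolded One_nat_def] is_cut_cutset below_cutset cutset_nodes arity_plain)

text \<open>Serves both shapes of the root: \<open>C'\<close> is all of \<open>C\<close> at a fork,
  and \<open>C\<close> without its last entry when the root itself is a cut.\<close>

lemma binary_cuts_branch:
  assumes "binary_cuts (Node x ts) C" "i < length ts" "set C' \<subseteq> set C"
    and "\<And>j. Suc j < length C' \<Longrightarrow> below (Node x ts) (C' ! j) (C' ! Suc j)"
    and "\<And>c. c \<in> set C' \<Longrightarrow> [] \<notin> c" "\<And>c. c \<in> set C - set C' \<Longrightarrow> c = {[]}"
  shows "binary_cuts (ts ! i) (map (branch i) C')"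
  unfolding binary_cuts_def
proof (intro conjI ballI allI impI)
  fix p assume "p \<in> nodes (ts ! i)"
  then show "1 \<le> arity (ts ! i) p" 
    using assms(1,2) unfolding binary_cuts_def by (metis arity_simps(2) nodes_simps(3))
next
  fix c assume "c \<in> set (map (branch i) C')"
  then obtain c0 where "c = branch i c0" "c0 \<in> set C'" by auto
  then show "is_cut (ts ! i) c"
    using assms is_cut_Node[of c0 x ts] unfolding binary_cuts_def by blast
next
  fix j assume j: "Suc j < length (map (branch i) C')"
  then have "[] \<notin> C' ! j" "[] \<notin> C' ! Suc j" using assms(5) by auto
  then show "below (ts ! i) (map (branch i) C' ! j) (map (branch i) C' ! Suc j)"
    using assms(4)[of j] j assms(2) below_Node[of "C' ! j" "C' ! Suc j" x ts] by simp
next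
  fix p assume "p \<in> \<Union> (set (map (branch i) C'))"
  then have "i # p \<in> \<Union> (set C)" using assms(3) by auto
  then have "arity (Node x ts) (i # p) = 1" using assms(1) unfolding binary_cuts_def by blast
  then show "arity (ts ! i) p = 1" using assms(2) by simp
next
  fix p assume p: "p \<in> nodes (ts ! i) - \<Union> (set (map (branch i) C'))"
  have "i # p \<notin> c" if "c \<in> set C" for c
    using p assms(6)[of c] that by (cases "c \<in> set C'") auto
  then have "arity (Node x ts) (i # p) = 2" using assms(1,2) p unfolding binary_cuts_def
    by (metis DiffD1 DiffI UnionE nodes_simps(3))
  then show "arity (ts ! i) p = 2" using assms(2) by simp
qed

text \<open>Nothing is strictly above the root, so no cut follows the one through the root in the
  list. Every other node shares a path to a leaf with the root, so it cannot belong to the same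
  cut.\<close>

lemma binary_cuts_root:
  assumes b: "binary_cuts (Node x ts) C" and i: "i < length C" "[] \<in> C ! i"
  shows "Suc i = length C" "C ! i = {[]}"
proof -
  obtain q where q: "q \<in> leaf_addresses (Node x ts)"
    using node_above_leaf[of "Node x ts" "[]"] b by (auto simp: binary_cuts_def)
  show "Suc i = length C"
  proof (rule ccontr)
    assume "Suc i \<noteq> length C"
    then have s: "Suc i < length C" using i by simp
    then have "is_cut (Node x ts) (C ! Suc i)" using b by (simp add: binary_cuts_def)
    then obtain p where p: "p \<in> C ! Suc i" "prefix p q" using q by (auto simp: is_cut_def)
    have "below (Node x ts) (C ! i) (C ! Suc i)" using b s by (simp add: binary_cuts_def)
    then have "strict_prefix p []" using q p i(2) unfolding below_def by (metis Nil_prefix)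
    then show False by simp
  qed
  have cut: "is_cut (Node x ts) (C ! i)" using b i by (simp add: binary_cuts_def)
  have "p = []" if p: "p \<in> C ! i" for p
  proof -
    have "p \<in> nodes (Node x ts)" using cut p by (auto simp: is_cut_def)
    then obtain q where "q \<in> leaf_addresses (Node x ts)" "prefix p q"
      using node_above_leaf[of "Node x ts" p] b by (auto simp: binary_cuts_def)
    then show ?thesis using cut p i unfolding is_cut_def by (metis Nil_prefix)
  qed
  then show "C ! i = {[]}" using i by auto
qed

text \<open>If some cut passes through the root, it is the top cut and is peeled off; otherwise the
  root is binary and every cut restricts to a cut of both subtrees.\<close>

lemma plain_binary_cuts:
  assumes "binary_cuts T C"
  shows "\<exists>t. uniform t \<and> T = plain t \<and> C = cuts t"
  using assms
proof (induction T arbitrary: C)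
  case Leaf
  have "C = []"
  proof (rule ccontr)
    assume "C \<noteq> []"
    moreover have "\<forall>c\<in>set C. is_cut (Leaf :: unit tree) c" using Leaf unfolding binary_cuts_def by blast
    ultimately have "is_cut (Leaf :: unit tree) (hd C)" using hd_in_set by blast
    then show False by (auto simp: is_cut_def)
  qed
  then show ?case by (intro exI[of _ Tip]) (simp add: cuts_def)
next
  case (Node x ts)
  show ?case
  proof (cases "\<exists>c\<in>set C. [] \<in> c")
    case True
    then obtain i where i: "i < length C" "[] \<in> C ! i" by (metis in_set_conv_nth)
    note root = binary_cuts_root[OF Node.prems i]
    define C' where "C' = butlast C"
    have C: "C = C' @ [{[]}]" using root i
      by (metis C'_def append_butlast_last_id diff_Suc_1 last_conv_nth length_greater_0_conv zero_less_Suc)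
    have no: "[] \<notin> c" if c: "c \<in> set C'" for c
    proof
      assume "[] \<in> c"
      obtain j where "j < length C'" "c = C' ! j" using c by (metis in_set_conv_nth)
      then show False using binary_cuts_root(1)[OF Node.prems, of j] \<open>[] \<in> c\<close> C by (simp add: nth_append)
    qed
    have "[] \<in> \<Union> (set C)" using C by auto
    then have "arity (Node x ts) [] = 1" using Node.prems unfolding binary_cuts_def by blast
    then obtain T where ts: "ts = [T]" by (auto simp: length_Suc_conv)
    have "binary_cuts (ts ! 0) (map (branch 0) C')"
    proof (rule binary_cuts_branch[OF Node.prems])
      fix j assume "Suc j < length C'"
      then show "below (Node x ts) (C' ! j) (C' ! Suc j)"
        using Node.prems C unfolding binary_cuts_def
        by (metis Suc_lessD butlast_snoc length_append_singleton less_SucI nth_butlast)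
    qed (use ts C no in auto)
    then obtain t where t: "uniform t" "T = plain t" "map (branch 0) C' = cuts t"
      using Node.IH ts by auto
    have len: "length C' = depth t" using t(3) by (metis cuts_def diff_zero length_map length_upt)
    have sub: "C' ! j = (#) 0 ` cutset t j" if j: "j < depth t" for j
    proof -
      have "branch 0 (C' ! j) = cutset t j" using t(3) j len
        by (metis cuts_def add_0 diff_zero length_upt nth_map nth_upt)
      moreover have "is_cut (Node x ts) (C' ! j)" "[] \<notin> C' ! j"
        using Node.prems C no j len by (auto simp: binary_cuts_def)
      then have "\<forall>i p. i # p \<in> C' ! j \<longrightarrow> i = 0"
        using is_cut_Node[of "C' ! j" x ts] ts by (metis One_nat_def length_Cons less_Suc0 list.size(3))
      ultimately show ?thesis using branch_decompose[of "C' ! j" "{0}"] \<open>[] \<notin> C' ! j\<close> by simp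
    qed
    have "C = cuts (Cut t)"
      by (rule nth_equalityI) (use C len sub in \<open>auto simp: cuts_def nth_append less_Suc_eq simp del: upt_Suc\<close>)
    then show ?thesis using t ts by (intro exI[of _ "Cut t"]) simp
  next
    case False
    then have "arity (Node x ts) [] = 2" using Node.prems unfolding binary_cuts_def
      by (metis DiffI UnionE nodes_simps(2))
    then obtain L R where ts: "ts = [L, R]" by (auto simp: length_Suc_conv numeral_2_eq_2)
    have "binary_cuts (ts ! j) (map (branch j) C)" if "j < 2" for j
    proof (rule binary_cuts_branch[OF Node.prems])
      fix j assume "Suc j < length C"
      then show "below (Node x ts) (C ! j) (C ! Suc j)"
        using Node.prems unfolding binary_cuts_def by blast
    qed (use ts False that in auto)
    from this[of 0] this[of 1] have "binary_cuts L (map (branch 0) C)" "binary_cuts R (map (branch 1) C)"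
      using ts by simp_all
    moreover have "L \<in> set ts" "R \<in> set ts" using ts by simp_all
    ultimately obtain l r where l: "uniform l" "L = plain l" "map (branch 0) C = cuts l"
      and r: "uniform r" "R = plain r" "map (branch 1) C = cuts r"
      using Node.IH by meson
    \<comment> \<open>Both subtrees are crossed by all the cuts in \<open>C\<close>, which is why
      their depths agree.\<close>
    have len: "length C = depth l" "length C = depth r"
      using l(3) r(3) by (metis cuts_def diff_zero length_map length_upt)+
    have sub: "C ! j = cutset (Fork l r) j" if j: "j < length C" for j
    proof -
      have b: "branch 0 (C ! j) = cutset l j" "branch 1 (C ! j) = cutset r j"
        using l(3) r(3) j len by (metis cuts_def add_0 diff_zero length_upt nth_map nth_upt)+
      moreover have "is_cut (Node x ts) (C ! j)" "[] \<notin> C ! j"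
        using Node.prems False j by (auto simp: binary_cuts_def)
      then have "\<forall>i p. i # p \<in> C ! j \<longrightarrow> i = 0 \<or> i = 1"
        using is_cut_Node[of "C ! j" x ts] ts by (metis One_nat_def length_Cons less_Suc0 less_SucE list.size(3))
      ultimately show ?thesis using branch_decompose[of "C ! j" "{0, 1}"] \<open>[] \<notin> C ! j\<close> by simp
    qed
    have "C = cuts (Fork l r)"
      by (rule nth_equalityI) (use len sub in \<open>auto simp: cuts_def\<close>)
    then show ?thesis using l r ts len by (intro exI[of _ "Fork l r"]) simp
  qed
qed

section \<open>Painted trees with their labels\<close>

definition encode :: "cut_tree \<Rightarrow> nat list \<Rightarrow> painted" where
  "encode t w = (plain t, cuts t, map (\<lambda>x. {x}) (rev w))"

lemma leaves_plain: "leaves (plain t) = Suc (forks t)"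
  by (induction t) auto

lemma length_cuts [simp]: "length (cuts t) = depth t"
  by (simp add: cuts_def)

text \<open>Words list labels downward, whereas ordered partitions list them upward.\<close>

lemma ordered_partition_singletons:
  "length \<mu> = m \<and> ordered_partition m \<mu> \<longleftrightarrow>
    (\<exists>w. distinct w \<and> set w = {1..m} \<and> \<mu> = map (\<lambda>x. {x}) (rev w))"
proof
  assume \<mu>: "length \<mu> = m \<and> ordered_partition m \<mu>"
  define v where "v = map (\<lambda>A. SOME x. x \<in> A) \<mu>"
  have len: "length v = m" using \<mu> by (simp add: v_def)
  have ne: "\<mu> ! i \<noteq> {}" if "i < m" for i
    using \<mu> that unfolding ordered_partition_def by (metis nth_mem)
  have disj: "i = j" if "i < m" "j < m" "x \<in> \<mu> ! i" "x \<in> \<mu> ! j" for i j x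
    using \<mu> that unfolding ordered_partition_def by blast
  have vi: "v ! i \<in> \<mu> ! i" if "i < m" for i
    using ne[OF that] that \<mu> by (simp add: v_def some_in_eq)
  have "distinct v"
    unfolding distinct_conv_nth using vi disj len by metis
  have "set v \<subseteq> {1..m}"
  proof
    fix x assume "x \<in> set v"
    then obtain i where "i < m" "x = v ! i" using len by (metis in_set_conv_nth)
    then have "x \<in> \<Union> (set \<mu>)" using vi[of i] \<mu> by (metis UnionI nth_mem)
    then show "x \<in> {1..m}" using \<mu> unfolding ordered_partition_def by blast
  qed
  then have set_v: "set v = {1..m}"
    using \<open>distinct v\<close> len by (intro card_subset_eq) (simp_all add: distinct_card)
  have "\<mu> ! i = {v ! i}" if i: "i < m" for i
  proof -
    have "x = v ! i" if x: "x \<in> \<mu> ! i" for x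
    proof -
      have "x \<in> \<Union> (set \<mu>)" using x i \<mu> by (metis UnionI nth_mem)
      then have "x \<in> set v" using \<mu> set_v unfolding ordered_partition_def by blast
      then obtain j where "j < m" "x = v ! j" using len by (metis in_set_conv_nth)
      then show ?thesis using disj[of i j x] vi[of j] i x by blast
    qed
    then show ?thesis using vi[OF i] by blast
  qed
  then have "\<mu> = map (\<lambda>x. {x}) v" using \<mu> len by (intro nth_equalityI) simp_all
  then show "\<exists>w. distinct w \<and> set w = {1..m} \<and> \<mu> = map (\<lambda>x. {x}) (rev w)"
    using \<open>distinct v\<close> set_v by (intro exI[of _ "rev v"]) simp
next
  assume "\<exists>w. distinct w \<and> set w = {1..m} \<and> \<mu> = map (\<lambda>x. {x}) (rev w)"
  then obtain v where v: "distinct v" "set v = {1..m}" "\<mu> = map (\<lambda>x. {x}) v"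
    by (metis distinct_rev set_rev)
  have "length v = m" using distinct_card[OF v(1)] v(2) by simp
  then show "length \<mu> = m \<and> ordered_partition m \<mu>"
    using v(2,3) nth_eq_iff_index_eq[OF v(1)] by (auto simp: ordered_partition_def)
qed

lemma binary_painted_tree_iff:
  "binary_painted_tree m n P \<longleftrightarrow> (\<exists>t w. well_formed {1..m} n t w \<and> P = encode t w)"
proof -
  obtain T C \<mu> where P: "P = (T, C, \<mu>)" by (cases P)
  have "binary_painted_tree m n P \<longleftrightarrow>
    binary_cuts T C \<and> leaves T = n + 1 \<and> length C = m \<and> length \<mu> = m \<and> ordered_partition m \<mu>"
  proof -
    have "{p \<in> nodes T. arity T p = 1} \<subseteq> \<Union> (set C)" if "binary_cuts T C"
    proof
      fix p assume p: "p \<in> {p \<in> nodes T. arity T p = 1}"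
      show "p \<in> \<Union> (set C)"
      proof (rule ccontr)
        assume "p \<notin> \<Union> (set C)"
        then have "arity T p = 2" using that p unfolding binary_cuts_def by blast
        then show False using p by simp
      qed
    qed
    then show ?thesis
      unfolding P binary_painted_tree_def painted_tree_def n_tree_def prod.case
      by (auto simp only: binary_cuts_def)
  qed
  also have "\<dots> \<longleftrightarrow> (\<exists>t. uniform t \<and> T = plain t \<and> C = cuts t \<and> forks t = n \<and> depth t = m) \<and>
    (\<exists>w. distinct w \<and> set w = {1..m} \<and> \<mu> = map (\<lambda>x. {x}) (rev w))"
    unfolding ordered_partition_singletons[symmetric]
    using plain_binary_cuts[of T C] binary_cuts_plain leaves_plain by auto blast
  also have "\<dots> \<longleftrightarrow> (\<exists>t w. well_formed {1..m} n t w \<and> P = encode t w)"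
  proof -
    have "length w = m" if "distinct w" "set w = {1..m}" for w :: "nat list"
      using distinct_card[OF that(1)] that(2) by simp
    then show ?thesis unfolding P encode_def well_formed_def by (metis (lifting) prod.inject)
  qed
  finally show ?thesis .
qed

section \<open>Rotations of painted trees as steps\<close>

lemma decorate_eq_Node:
  "decorate t = Node x ts \<longleftrightarrow>
    (\<exists>t1. t = Cut t1 \<and> x = {depth t1} \<and> ts = [decorate t1]) \<or>
    (\<exists>l r. t = Fork l r \<and> x = {} \<and> ts = [decorate l, decorate r])"
  by (cases t) auto

lemma Node_eq_decorate:
  "Node x ts = decorate t \<longleftrightarrow>
    (\<exists>t1. t = Cut t1 \<and> x = {depth t1} \<and> ts = [decorate t1]) \<or>
    (\<exists>l r. t = Fork l r \<and> x = {} \<and> ts = [decorate l, decorate r])"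
  by (cases t) auto

lemma decorate_inject: "decorate t = decorate t' \<longleftrightarrow> t = t'"
proof
  show "decorate t = decorate t' \<Longrightarrow> t = t'"
  proof (induction t arbitrary: t')
    case Tip
    then show ?case by (cases t') auto
  next
    case (Cut t)
    then show ?case by (cases t') auto
  next
    case (Fork l r)
    then show ?case by (cases t') auto
  qed
qed simp

lemma decorate_label:
  "uniform t \<Longrightarrow> subtree_at (decorate t) p = Some (Node x ts) \<Longrightarrow> x = {i. p \<in> cutset t i}"
proof (induction t arbitrary: p)
  case Tip
  then show ?case by (cases p) auto
next
  case (Cut t)
  then show ?case
  proof (cases p)
    case (Cons i p')
    then have "i = 0" "x = {i. p' \<in> cutset t i}" using Cut by (auto split: if_splits)
    then show ?thesis using Cons Cut.prems(1) cutset_depth[of t p'] by auto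
  qed auto
next
  case (Fork l r)
  then show ?case
  proof (cases p)
    case (Cons i p')
    then consider "i = 0" "subtree_at (decorate l) p' = Some (Node x ts)"
      | "i = 1" "subtree_at (decorate r) p' = Some (Node x ts)"
      using Fork.prems by (auto split: if_splits simp: less_Suc_eq)
    then show ?thesis using Fork Cons by cases auto
  qed auto
qed

lemma depicts_decorate: "uniform t \<Longrightarrow> depicts (decorate t) (plain t) (cuts t)"
proof -
  have "map_tree (\<lambda>_. ()) (decorate t) = plain t" by (induction t) auto
  then show "uniform t \<Longrightarrow> depicts (decorate t) (plain t) (cuts t)"
    using decorate_label by (auto simp: depicts_def cut_indices_cuts)
qed

lemma tree_eqI:
  assumes "map_tree f D = map_tree g D'"
    and "\<And>p x ts y us. subtree_at D p = Some (Node x ts) \<Longrightarrow> subtree_at D' p = Some (Node y us) \<Longrightarrow> x = y"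
  shows "D = D'"
  using assms
proof (induction D arbitrary: D')
  case Leaf
  then show ?case by (cases D') auto
next
  case (Node x ts)
  then obtain y us where D': "D' = Node y us" by (cases D') auto
  have maps: "map (map_tree f) ts = map (map_tree g) us" using Node.prems(1) D' by simp
  then have len: "length ts = length us" by (metis length_map)
  have "ts = us"
  proof (rule nth_equalityI[OF len])
    fix i assume i: "i < length ts"
    show "ts ! i = us ! i"
    proof (rule Node.IH)
      show "map_tree f (ts ! i) = map_tree g (us ! i)" using maps i len by (metis nth_map)
      show "x' = y'" if "subtree_at (ts ! i) p = Some (Node x' ts')" "subtree_at (us ! i) p = Some (Node y' us')"
        for p x' ts' y' us'
        using Node.prems(2)[of "i # p" x' ts' y' us'] that i len D' by simp
    qed (use i in simp)
  qed
  moreover have "x = y" using Node.prems(2)[of "[]" x ts y us] D' by simp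
  ultimately show ?case using D' by simp
qed

lemma depicts_unique: "depicts D T C \<Longrightarrow> depicts D' T C \<Longrightarrow> D = D'"
  unfolding depicts_def by (rule tree_eqI[of "\<lambda>_. ()" D "\<lambda>_. ()" D']) (metis+)

lemma plain_cuts_inject:
  assumes "uniform t" "uniform t'" "plain t = plain t'" "cuts t = cuts t'"
  shows "t = t'"
  using depicts_unique depicts_decorate assms by (metis decorate_inject)

lemma local_rotation_decorate:
  assumes "uniform t"
  shows "local_rotation (decorate t) (decorate t') \<longleftrightarrow> rot t t'"
proof
  assume "rot t t'"
  then show "local_rotation (decorate t) (decorate t')" using assms
  proof (induction rule: rot.induct)
    case (rot_edge a b c)
    show ?case by (simp add: local_rotation.rotate_edge)
  next
    \<comment> \<open>Uniformity gives the two lower cut nodes the same index, as the rule for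
      raising a cut demands.\<close>
    case (rot_raise a b)
    then show ?case by (simp add: local_rotation.raise_cut)
  next
    case (rot_Cut t t')
    then show ?case using in_context[of "decorate t" "decorate t'" "{depth t}" "[]" "[]"]
      by (simp add: rot_depth)
  next
    case (rot_left t t' u)
    then show ?case using in_context[of "decorate t" "decorate t'" "{}" "[]" "[decorate u]"] by simp
  next
    case (rot_right t t' u)
    then show ?case using in_context[of "decorate t" "decorate t'" "{}" "[decorate u]" "[]"] by simp
  qed
next
  have "rot t t'" if "local_rotation D D'" "D = decorate t" "D' = decorate t'" for D D' t t'
    using that
  proof (induction arbitrary: t t' rule: local_rotation.induct)
    case (rotate_edge a b c)
    then show ?case
      by (auto simp: decorate_eq_Node Node_eq_decorate decorate_inject intro: rot.rot_edge)
  next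
    case (raise_cut i a b)
    then show ?case
      by (auto simp: decorate_eq_Node Node_eq_decorate decorate_inject intro: rot.rot_raise)
  next
    case (in_context s s' x us vs)
    note t = in_context.prems[symmetric, unfolded decorate_eq_Node]
    show ?case
    proof (cases t)
      case Tip
      then show ?thesis using t by simp
    next
      case (Cut t1)
      then have "x = {depth t1}" "us = []" "vs = []" "s = decorate t1" 
        using t(1) by (auto simp: append_eq_Cons_conv)
      then obtain t1' where "t' = Cut t1'" "s' = decorate t1'" using t(2) by auto
      then show ?thesis using in_context.IH[OF \<open>s = decorate t1\<close>] Cut by (simp add: rot_Cut)
    next
      case (Fork l r)
      then have "x = {}" and us: "us @ s # vs = [decorate l, decorate r]" using t(1) by auto
      then obtain l' r' where t': "t' = Fork l' r'" and us': "us @ s' # vs = [decorate l', decorate r']"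
        using t(2) by auto
      consider "us = []" "vs = [decorate r]" "s = decorate l" | "us = [decorate l]" "vs = []" "s = decorate r"
        using us by (auto simp: append_eq_Cons_conv)
      then show ?thesis
      proof cases
        case 1
        then have "s' = decorate l'" "r' = r" using us' by (auto simp: decorate_inject)
        then show ?thesis using in_context.IH[OF 1(3)] t' Fork by (simp add: rot_left)
      next
        case 2
        then have "s' = decorate r'" "l' = l" using us' by (auto simp: decorate_inject)
        then show ?thesis using in_context.IH[OF 2(3)] t' Fork by (simp add: rot_right)
      qed
    qed
  qed
  then show "local_rotation (decorate t) (decorate t') \<Longrightarrow> rot t t'" by blast
qed

lemma cutset_nonempty: "uniform t \<Longrightarrow> i < depth t \<Longrightarrow> cutset t i \<noteq> {}"
  by (induction t) auto

text \<open>Some node lies above the top cut just when the tree starts with a \<open>Fork\<close>,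
  and then the root has all the cuts beneath it.\<close>

lemma between_top_cuts:
  assumes "uniform t" "depth t = Suc i"
  shows "(\<exists>p\<in>nodes (plain t). \<exists>r\<in>cutset t i. strict_prefix p r) \<longleftrightarrow> (\<exists>x<forks t. cuts_under t x = Suc i)"
proof (cases t)
  case Tip
  then show ?thesis using assms by simp
next
  case (Cut t1)
  then show ?thesis using assms cuts_under_le[of t1] by fastforce
next
  case (Fork l r)
  obtain c where "c \<in> cutset l i" using cutset_nonempty[of l i] assms Fork by auto
  then have "0 # c \<in> cutset t i" "[] \<in> nodes (plain t)" using Fork by auto
  then have "\<exists>p\<in>nodes (plain t). \<exists>r\<in>cutset t i. strict_prefix p r" by (metis prefix_bot.bot_less list.distinct(1))
  moreover have "\<exists>x<forks t. cuts_under t x = Suc i"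
    using Fork assms by (intro exI[of _ "forks l"]) simp
  ultimately show ?thesis by blast
qed

text \<open>The cuts beneath a node strictly between cut \<open>Suc i\<close> and cut
  \<open>i\<close> are those with indices \<open>0\<close> to \<open>i\<close>, which are
  \<open>Suc i\<close> in number. Once cut \<open>Suc i\<close> is at the root, the claim reduces to
  \<open>between_top_cuts\<close> for its child.\<close>

lemma between_cuts:
  assumes "uniform t" "Suc i < depth t"
  shows "(\<exists>p\<in>nodes (plain t). \<exists>q\<in>cutset t (Suc i). \<exists>r\<in>cutset t i. strict_prefix q p \<and> strict_prefix p r) \<longleftrightarrow>
    (\<exists>x<forks t. cuts_under t x = Suc i)"
  using assms
proof (induction t)
  case (Cut t)
  show ?case
  proof (cases "depth t = Suc i")
    case True
    have "(\<exists>p\<in>nodes (plain (Cut t)). \<exists>q\<in>cutset (Cut t) (Suc i). \<exists>r\<in>cutset (Cut t) i. strict_prefix q p \<and> strict_prefix p r)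
      \<longleftrightarrow> (\<exists>p\<in>nodes (plain t). \<exists>r\<in>cutset t i. strict_prefix p r)" (is "?L \<longleftrightarrow> ?R")
    proof
      assume ?L
      then obtain p r where pr: "p \<in> nodes (plain (Cut t))" "r \<in> cutset t i" "strict_prefix [] p" "strict_prefix p (0 # r)"
        using True by auto
      then obtain p' where "p = 0 # p'" by (cases p) auto
      then show ?R using pr by auto
    next
      assume ?R
      then obtain p r where "p \<in> nodes (plain t)" "r \<in> cutset t i" "strict_prefix p r" by blast
      then have "0 # p \<in> nodes (plain (Cut t))" "0 # r \<in> cutset (Cut t) i" "strict_prefix [] (0 # p)"
        "strict_prefix (0 # p) (0 # r)" "[] \<in> cutset (Cut t) (Suc i)"
        using True by auto
      then show ?L by blast
    qed
    then show ?thesis using between_top_cuts[of t i] Cut.prems True by simp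
  next
    case False
    have "(\<exists>p\<in>nodes (plain (Cut t)). \<exists>q\<in>cutset (Cut t) (Suc i). \<exists>r\<in>cutset (Cut t) i. strict_prefix q p \<and> strict_prefix p r)
      \<longleftrightarrow> (\<exists>p\<in>nodes (plain t). \<exists>q\<in>cutset t (Suc i). \<exists>r\<in>cutset t i. strict_prefix q p \<and> strict_prefix p r)" (is "?L \<longleftrightarrow> ?R")
    proof
      assume ?L
      then obtain p q r where pr: "p \<in> nodes (plain (Cut t))" "q \<in> cutset t (Suc i)" "r \<in> cutset t i"
          "strict_prefix (0 # q) p" "strict_prefix p (0 # r)"
        using False Cut.prems by auto
      then obtain p' where "p = 0 # p'" by (cases p) auto
      then show ?R using pr by auto
    next
      assume ?R
      then obtain p q r where "p \<in> nodes (plain t)" "q \<in> cutset t (Suc i)" "r \<in> cutset t i"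
        "strict_prefix q p" "strict_prefix p r" by blast
      then have "0 # p \<in> nodes (plain (Cut t))" "0 # r \<in> cutset (Cut t) i" "strict_prefix (0 # q) (0 # p)"
        "strict_prefix (0 # p) (0 # r)" "0 # q \<in> cutset (Cut t) (Suc i)"
        using False Cut.prems by auto
      then show ?L by blast
    qed
    then show ?thesis using Cut False by simp
  qed
next
  case (Fork l r)
  let ?P = "\<lambda>t. \<exists>p\<in>nodes (plain t). \<exists>q\<in>cutset t (Suc i). \<exists>r\<in>cutset t i. strict_prefix q p \<and> strict_prefix p r"
  have "?P (Fork l r) \<longleftrightarrow> ?P l \<or> ?P r"
  proof
    assume "?P (Fork l r)"
    then obtain p q s where pr: "p \<in> nodes (plain (Fork l r))" "q \<in> cutset (Fork l r) (Suc i)" 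
        "s \<in> cutset (Fork l r) i" "strict_prefix q p" "strict_prefix p s" by blast
    then obtain j q' where q: "q = j # q'" by auto
    then obtain p' where p: "p = j # p'" "strict_prefix q' p'" using pr(4) by (cases p) auto
    then obtain s' where s: "s = j # s'" "strict_prefix p' s'" using pr(5) by (cases s) auto
    have "j = 0 \<or> j = 1" using pr(1) p by (auto simp: less_Suc_eq)
    then show "?P l \<or> ?P r" using pr q p s by auto
  next
    assume "?P l \<or> ?P r"
    then show "?P (Fork l r)"
    proof
      assume "?P l"
      then obtain p q s where "p \<in> nodes (plain l)" "q \<in> cutset l (Suc i)" "s \<in> cutset l i"
        "strict_prefix q p" "strict_prefix p s" by blast
      then have "0 # p \<in> nodes (plain (Fork l r))" "0 # s \<in> cutset (Fork l r) i" "strict_prefix (0 # q) (0 # p)"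
        "strict_prefix (0 # p) (0 # s)" "0 # q \<in> cutset (Fork l r) (Suc i)" by auto
      then show ?thesis by blast
    next
      assume "?P r"
      then obtain p q s where "p \<in> nodes (plain r)" "q \<in> cutset r (Suc i)" "s \<in> cutset r i"
        "strict_prefix q p" "strict_prefix p s" by blast
      then have "1 # p \<in> nodes (plain (Fork l r))" "1 # s \<in> cutset (Fork l r) i" "strict_prefix (1 # q) (1 # p)"
        "strict_prefix (1 # p) (1 # s)" "1 # q \<in> cutset (Fork l r) (Suc i)" by auto
      then show ?thesis by blast
    qed
  qed
  moreover have "(\<exists>x<forks (Fork l r). cuts_under (Fork l r) x = Suc i) \<longleftrightarrow>
    (\<exists>x<forks l. cuts_under l x = Suc i) \<or> (\<exists>x<forks r. cuts_under r x = Suc i)" (is "?L \<longleftrightarrow> ?R")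
  proof
    assume ?L
    then obtain x where "x < forks (Fork l r)" "cuts_under (Fork l r) x = Suc i" by blast
    then show ?R using Fork.prems by (cases rule: fork_cases) auto
  next
    assume ?R
    then show ?L
    proof (elim disjE exE conjE)
      fix x assume "x < forks l" "cuts_under l x = Suc i"
      then show ?L by (intro exI[of _ x]) simp
    next
      fix x assume "x < forks r" "cuts_under r x = Suc i"
      then show ?L by (intro exI[of _ "Suc (forks l + x)"]) simp
    qed
  qed
  ultimately show ?case using Fork by simp
qed simp

lemma encode_inject:
  assumes "uniform t" "uniform t'" "encode t w = encode t' w'"
  shows "t = t' \<and> w = w'"
proof -
  have "inj (\<lambda>x::nat. {x})" by (simp add: inj_def)
  then show ?thesis using plain_cuts_inject[OF assms(1,2)] assms(3) by (auto simp: encode_def inj_map_eq_map)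
qed

text \<open>Positions are mirrored: cut \<open>i\<close> carries entry \<open>i\<close> of
  \<open>rev w\<close>, so the lower of the two exchanged labels is followed in \<open>w\<close> by
  a suffix \<open>v\<close> of length \<open>i\<close>.\<close>

lemma label_exchange_encode:
  assumes "well_formed A n t w" "well_formed A n t' w'"
  shows "label_exchange (encode t w) (encode t' w') \<longleftrightarrow>
    t' = t \<and> (\<exists>a b u v. a < b \<and> w = u @ b # a # v \<and> w' = u @ a # b # v \<and>
      (\<forall>x<forks t. cuts_under t x \<noteq> Suc (length v)))" (is "?L \<longleftrightarrow> ?R")
proof
  have u: "uniform t" "uniform t'" "depth t = length w" using assms by (auto simp: well_formed_def)
  have inj: "inj (\<lambda>x::nat. {x})" by (simp add: inj_def)
  have gap: "(\<exists>p\<in>nodes (plain t). \<exists>q\<in>cuts t ! Suc i. \<exists>r\<in>cuts t ! i. strict_prefix q p \<and> strict_prefix p r)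
    \<longleftrightarrow> (\<exists>x<forks t. cuts_under t x = Suc i)" if "Suc i < depth t" for i
    using between_cuts[OF u(1) that] that by (simp add: cuts_def)
  {
    assume ?L
    then obtain i a b where eq: "plain t' = plain t" "cuts t' = cuts t" and i: "Suc i < depth t"
      and ab: "a < b" "map (\<lambda>x. {x}) (rev w) ! i = {a}" "map (\<lambda>x. {x}) (rev w) ! Suc i = {b}"
      and free: "\<not> (\<exists>p\<in>nodes (plain t). \<exists>q\<in>cuts t ! Suc i. \<exists>r\<in>cuts t ! i. strict_prefix q p \<and> strict_prefix p r)"
      and w': "map (\<lambda>x. {x}) (rev w') = (map (\<lambda>x. {x}) (rev w))[i := {b}, Suc i := {a}]"
      unfolding label_exchange_def encode_def by auto
    have "t' = t" using plain_cuts_inject u eq by blast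
    define p where "p = take i (rev w)"
    define q where "q = drop (Suc (Suc i)) (rev w)"
    have "rev w ! i = a" "rev w ! Suc i = b" using ab i u by simp_all
    then have rw: "rev w = p @ a # b # q"
      unfolding p_def q_def using i u
      by (metis Cons_nth_drop_Suc Suc_lessD append_take_drop_id length_rev)
    have len: "length p = i" using i u by (simp add: p_def)
    have "map (\<lambda>x. {x}) (rev w') = map (\<lambda>x. {x}) (p @ b # a # q)"
      using w' len unfolding rw by (simp add: list_update_append)
    then have "rev w' = p @ b # a # q" using inj by (simp only: inj_map_eq_map)
    then have "w' = rev q @ a # b # rev p" "w = rev q @ b # a # rev p"
      using rw by (metis append.assoc append_Cons append_Nil rev.simps(2) rev_append rev_rev_ident)+
    then show ?R using \<open>t' = t\<close> ab(1) free gap[OF i] len by (metis length_rev)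
  next
    assume ?R
    then obtain a b r v where r: "t' = t" "a < b" "w = r @ b # a # v" "w' = r @ a # b # v"
      "\<forall>x<forks t. cuts_under t x \<noteq> Suc (length v)" by blast
    have i: "Suc (length v) < depth t" using u r by simp
    show ?L
      unfolding label_exchange_def encode_def prod.case
    proof (intro conjI exI)
      show "\<not> (\<exists>p\<in>nodes (plain t). \<exists>q\<in>cuts t ! Suc (length v). \<exists>r\<in>cuts t ! length v.
          strict_prefix q p \<and> strict_prefix p r)"
        using gap[OF i] r(5) by blast
    qed (use r i in \<open>simp_all add: nth_append list_update_append\<close>)
  }
qed

lemma painted_rotation_iff:
  "painted_rotation m n P P' \<longleftrightarrow> (\<exists>t w t' w'. P = encode t w \<and> P' = encode t' w' \<and>
     well_formed {1..m} n t w \<and> well_formed {1..m} n t' w' \<and> step (t, w) (t', w'))"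
proof -
  have core: "((\<exists>D D'. depicts D (plain t) (cuts t) \<and> depicts D' (plain t') (cuts t') \<and> local_rotation D D' \<and>
      map (\<lambda>x. {x}) (rev w') = map (\<lambda>x. {x}) (rev w)) \<or> label_exchange (encode t w) (encode t' w'))
    \<longleftrightarrow> step (t, w) (t', w')" (is "?L \<or> ?E \<longleftrightarrow> ?S")
    if wf: "well_formed {1..m} n t w" "well_formed {1..m} n t' w'" for t w t' w'
  proof -
    have u: "uniform t" "uniform t'" using wf by (auto simp: well_formed_def)
    have "inj (\<lambda>x::nat. {x})" by (simp add: inj_def)
    then have "map (\<lambda>x. {x}) (rev w') = map (\<lambda>x. {x}) (rev w) \<longleftrightarrow> w' = w"
      by (simp only: inj_map_eq_map rev_is_rev_conv)
    moreover have "depicts D (plain s) (cuts s) \<longleftrightarrow> D = decorate s" if "uniform s" for D s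
      using depicts_unique depicts_decorate[OF that] by blast
    ultimately have "?L \<longleftrightarrow> rot t t' \<and> w' = w"
      using u local_rotation_decorate[OF u(1), of t'] by simp
    moreover have "?S \<longleftrightarrow> rot t t' \<and> w' = w \<or> t' = t \<and> (\<exists>a b u v. a < b \<and> w = u @ b # a # v \<and> w' = u @ a # b # v \<and>
      (\<forall>x<forks t. cuts_under t x \<noteq> Suc (length v)))"
      unfolding step.simps prod.inject by blast
    ultimately show ?thesis using label_exchange_encode[OF wf] by simp
  qed
  have "painted_rotation m n P P' \<longleftrightarrow> binary_painted_tree m n P \<and> binary_painted_tree m n P' \<and>
    ((\<exists>D D'. depicts D (fst P) (fst (snd P)) \<and> depicts D' (fst P') (fst (snd P')) \<and> local_rotation D D' \<and>
      snd (snd P') = snd (snd P)) \<or> label_exchange P P')"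
    by (cases P; cases P') (simp add: painted_rotation_def)
  also have "\<dots> \<longleftrightarrow> (\<exists>t w t' w'. P = encode t w \<and> P' = encode t' w' \<and>
     well_formed {1..m} n t w \<and> well_formed {1..m} n t' w' \<and> step (t, w) (t', w'))"
  proof -
    have enc: "fst (encode t w) = plain t" "fst (snd (encode t w)) = cuts t"
      "snd (snd (encode t w)) = map (\<lambda>x. {x}) (rev w)" for t w by (simp_all add: encode_def)
    show ?thesis
      unfolding binary_painted_tree_iff
    proof (intro iffI; elim conjE exE)
      fix t w t' w'
      assume "well_formed {1..m} n t w" "P = encode t w" "well_formed {1..m} n t' w'" "P' = encode t' w'"
        and "(\<exists>D D'. depicts D (fst P) (fst (snd P)) \<and> depicts D' (fst P') (fst (snd P')) \<and> local_rotation D D' \<and>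
          snd (snd P') = snd (snd P)) \<or> label_exchange P P'"
      then show "\<exists>t w t' w'. P = encode t w \<and> P' = encode t' w' \<and>
          well_formed {1..m} n t w \<and> well_formed {1..m} n t' w' \<and> step (t, w) (t', w')"
        using core[of t w t' w'] unfolding enc by (metis enc)
    next
      fix t w t' w'
      assume a: "P = encode t w" "P' = encode t' w'" "well_formed {1..m} n t w" "well_formed {1..m} n t' w'"
        "step (t, w) (t', w')"
      show "(\<exists>t w. well_formed {1..m} n t w \<and> P = encode t w) \<and> (\<exists>t w. well_formed {1..m} n t w \<and> P' = encode t w) \<and>
        ((\<exists>D D'. depicts D (fst P) (fst (snd P)) \<and> depicts D' (fst P') (fst (snd P')) \<and> local_rotation D D' \<and>
          snd (snd P') = snd (snd P)) \<or> label_exchange P P')"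
        using core[OF a(3,4)] a(5) a(1-4) unfolding a(1,2) enc by blast
    qed
  qed
  finally show ?thesis .
qed

lemma painted_rotations_iff:
  assumes "well_formed {1..m} n t w"
  shows "(painted_rotation m n)\<^sup>*\<^sup>* (encode t w) P \<longleftrightarrow> (\<exists>t' w'. P = encode t' w' \<and> step\<^sup>*\<^sup>* (t, w) (t', w'))"
proof
  assume "(painted_rotation m n)\<^sup>*\<^sup>* (encode t w) P"
  then show "\<exists>t' w'. P = encode t' w' \<and> step\<^sup>*\<^sup>* (t, w) (t', w')"
  proof (induction rule: rtranclp_induct)
    case base
    show ?case by blast
  next
    case (step P Q)
    then obtain t1 w1 where 1: "P = encode t1 w1" "step\<^sup>*\<^sup>* (t, w) (t1, w1)" by blast
    obtain t2 w2 t3 w3 where 2: "P = encode t2 w2" "Q = encode t3 w3" "well_formed {1..m} n t2 w2"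
      "step (t2, w2) (t3, w3)"
      using step.hyps(2) unfolding painted_rotation_iff by blast
    have "well_formed {1..m} n t1 w1" using steps_well_formed[OF 1(2) assms] .
    then have "t1 = t2 \<and> w1 = w2" using encode_inject[of t1 t2 w1 w2] 1 2 by (auto simp: well_formed_def)
    then have "step\<^sup>*\<^sup>* (t, w) (t3, w3)" using 1(2) 2(4) by (metis rtranclp.rtrancl_into_rtrancl)
    then show ?case using 2(2) by blast
  qed
next
  assume "\<exists>t' w'. P = encode t' w' \<and> step\<^sup>*\<^sup>* (t, w) (t', w')"
  then obtain t' w' where P: "P = encode t' w'" and s: "step\<^sup>*\<^sup>* (t, w) (t', w')" by blast
  from s show "(painted_rotation m n)\<^sup>*\<^sup>* (encode t w) P"
    unfolding P
  proof (induction rule: rtranclp_induct2)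
    case (step t1 w1 t2 w2)
    have "painted_rotation m n (encode t1 w1) (encode t2 w2)"
      unfolding painted_rotation_iff
      using step steps_well_formed assms step_well_formed by blast
    then show ?case using step.IH by simp
  qed simp
qed

section \<open>Shadows and shades in terms of encoded trees\<close>

lemma shadow_encode:
  assumes "uniform t" "depth t = length w"
  shows "shadow (encode t w) = shade_of t w"
proof -
  \<comment> \<open>The labelling \<open>f\<close> is a parameter and is indexed from the bottom, so
    it stays the same when the induction removes the top cut and the first letter of the
    word.\<close>
  define entry where "entry = (\<lambda>(f :: nat \<Rightarrow> nat set) t p. (map leaves (butlast (children (plain t) p)), \<Union>i\<in>{i. p \<in> cutset t i}. f i))"
  have main: "map (entry f t) (right_branch (plain t)) = shade_of t w"
    if "uniform t" "depth t = length w" "\<And>i. i < length w \<Longrightarrow> f i = {rev w ! i}" for f :: "nat \<Rightarrow> nat set" and t w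
    using that
  proof (induction t w rule: shade_of.induct)
    case (2 t w)
    obtain a v where w: "w = a # v" using 2 by (cases w) auto
    have "f i = {rev v ! i}" if "i < length v" for i using 2(4)[of i] that w by (simp add: nth_append)
    then have IH: "map (entry f t) (right_branch (plain t)) = shade_of t v" using 2 w by simp
    have "entry f (Cut t) [] = ([], {a})"
      using 2(3) 2(4)[of "length v"] w by (simp add: entry_def nth_append image_iff)
    moreover have "entry f (Cut t) (0 # p) = entry f t p" for p
    proof -
      have "{i. 0 # p \<in> cutset (Cut t) i} = {i. p \<in> cutset t i}"
        using cutset_depth[of t p] 2(2) by auto
      then show ?thesis by (simp add: entry_def)
    qed
    ultimately show ?case using IH w by (simp add: comp_def)
  next
    case (3 l r w)
    have "map (entry f r) (right_branch (plain r)) = shade_of r w" using 3 by simp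
    moreover have "entry f (Fork l r) [] = ([Suc (forks l)], {})"
      by (simp add: entry_def leaves_plain)
    moreover have "entry f (Fork l r) (Suc 0 # p) = entry f r p" for p
      by (simp add: entry_def)
    ultimately show ?case by (simp add: comp_def)
  qed simp
  have "shadow (encode t w) = map (entry (\<lambda>i. map (\<lambda>x. {x}) (rev w) ! i) t) (right_branch (plain t))"
    unfolding shadow_def encode_def entry_def prod.case cut_indices_cuts[OF assms(1)] ..
  also have "\<dots> = shade_of t w" by (rule main) (use assms in auto)
  finally show ?thesis .
qed

lemma lights_union:
  "\<forall>x\<in>set S. unary_entry x \<Longrightarrow> (\<Union>(s, c)\<in>set S. c) = set (lights S)"
  by (induction rule: shade_induct) auto

lemma disjoint_nth_Cons:
  "(\<forall>i<length (x # S). \<forall>j<length (x # S). i \<noteq> j \<longrightarrow> f ((x # S) ! i) \<inter> f ((x # S) ! j) = {}) \<longleftrightarrow>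
    (\<forall>y\<in>set S. f x \<inter> f y = {}) \<and>
    (\<forall>i<length S. \<forall>j<length S. i \<noteq> j \<longrightarrow> f (S ! i) \<inter> f (S ! j) = {})"
proof -
  have "f (S ! i) \<inter> f x = f x \<inter> f (S ! i)" for i by (rule Int_commute)
  then show ?thesis by (simp add: All_less_Suc2 all_set_conv_all_nth) blast
qed

lemma lights_disjoint:
  assumes "\<forall>x\<in>set S. unary_entry x"
  shows "(\<forall>i<length S. \<forall>j<length S. i \<noteq> j \<longrightarrow> snd (S ! i) \<inter> snd (S ! j) = {}) \<longleftrightarrow> distinct (lights S)"
  using assms
proof (induction rule: shade_induct)
  case (cut a S)
  have "(\<forall>y\<in>set S. {a} \<inter> snd y = {}) \<longleftrightarrow> a \<notin> (\<Union>(s, c)\<in>set S. c)" by fastforce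
  then show ?case unfolding disjoint_nth_Cons using cut.IH lights_union[OF cut.hyps] by simp
next
  case (tuple r S)
  then show ?case unfolding disjoint_nth_Cons by simp
qed simp

lemma unary_shade_iff: "unary_shade m n S \<longleftrightarrow> proper_shade {1..m} n S"
proof -
  have "unary_shade m n S \<Longrightarrow> \<forall>x\<in>set S. unary_entry x"
    unfolding unary_shade_def lighted_shade_def unary_entry_def by fastforce
  moreover have "unary_shade m n S \<longleftrightarrow> proper_shade {1..m} n S" if "\<forall>x\<in>set S. unary_entry x"
  proof -
    have "\<forall>(s, c)\<in>set S. (\<forall>r\<in>set s. r > 0) \<and> (s = [] \<longrightarrow> c \<noteq> {})"
      "\<forall>(s, c)\<in>set S. (s = [] \<and> (\<exists>a. c = {a})) \<or> (c = {} \<and> (\<exists>r. s = [r]))"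
      using that unfolding unary_entry_def by fastforce+
    moreover have sum_fst: "(\<lambda>(s, c). sum_list s) = (\<lambda>x. sum_list (fst x))" by (auto simp: fun_eq_iff)
    ultimately show ?thesis
      unfolding unary_shade_def lighted_shade_def proper_shade_def sum_fst
      using that lights_union[OF that] lights_disjoint[OF that] by auto
  qed
  ultimately show ?thesis by (auto simp: proper_shade_def)
qed

lemma shadow_encode_wf: "well_formed A n t w \<Longrightarrow> shadow (encode t w) = shade_of t w"
  by (simp add: shadow_encode well_formed_def)

lemma shade_of_steps:
  assumes "well_formed {1..m} n t w" "step\<^sup>*\<^sup>* (t, w) (t', w')"
  shows "(shade_rotation m n)\<^sup>*\<^sup>* (shade_of t w) (shade_of t' w')"
  using assms(2)
proof (induction rule: rtranclp_induct2)
  case (step t1 w1 t2 w2)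
  have wf1: "well_formed {1..m} n t1 w1" using steps_well_formed[OF step.hyps(1) assms(1)] .
  have wf2: "well_formed {1..m} n t2 w2" using step_well_formed[OF step.hyps(2) wf1] .
  have "shade_of t2 w2 = shade_of t1 w1 \<or> shade_rotation m n (shade_of t1 w1) (shade_of t2 w2)"
    unfolding shade_rotation_def unary_shade_iff
    using shade_of_step[OF step.hyps(2) wf1] proper_shade_of wf1 wf2 by blast
  then show ?case using step.IH by auto
qed simp

lemma grow_steps:
  assumes "(shade_rotation m n)\<^sup>*\<^sup>* S S'"
  shows "step\<^sup>*\<^sup>* (grow S, lights S) (grow S', lights S')"
  using assms
proof (induction rule: rtranclp_induct)
  case (step S1 S2)
  then have "step\<^sup>*\<^sup>* (grow S1, lights S1) (grow S2, lights S2)"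
    using grow_move unfolding shade_rotation_def unary_shade_iff by blast
  then show ?case using step.IH by simp
qed simp

section \<open>The shadow map preserves meets\<close>

text \<open>This is the Galois connection. One direction applies the monotone \<open>grow\<close>
  and then \<open>grow_shade_of\<close>; the other applies the monotone shadow and uses that
  \<open>grow\<close> and \<open>lights\<close> form a section of it.\<close>

lemma shade_le_iff:
  assumes "proper_shade {1..m} n S" "well_formed {1..m} n t w"
  shows "(shade_rotation m n)\<^sup>*\<^sup>* S (shade_of t w) \<longleftrightarrow> step\<^sup>*\<^sup>* (grow S, lights S) (t, w)"
proof
  assume "(shade_rotation m n)\<^sup>*\<^sup>* S (shade_of t w)"
  then have "step\<^sup>*\<^sup>* (grow S, lights S) (grow (shade_of t w), lights (shade_of t w))"
    by (rule grow_steps)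
  moreover have "step\<^sup>*\<^sup>* (grow (shade_of t w), lights (shade_of t w)) (t, w)"
    using assms(2) step_rots[OF grow_shade_of, of t w w] shade_of_props(2)[of t w]
    by (simp add: well_formed_def)
  ultimately show "step\<^sup>*\<^sup>* (grow S, lights S) (t, w)" by simp
next
  assume "step\<^sup>*\<^sup>* (grow S, lights S) (t, w)"
  from shade_of_steps[OF well_formed_grow[OF assms(1)] this]
  show "(shade_rotation m n)\<^sup>*\<^sup>* S (shade_of t w)"
    using grow_props(4)[of S] assms(1) by (simp add: proper_shade_def)
qed

text \<open>The infimum is some greatest lower bound picked by Hilbert choice; antisymmetry leaves
  \<open>z\<close> as the only candidate.\<close>

lemma inf_eqI:
  fixes L :: "('a, 'b) gorder_scheme"
  assumes "x \<in> carrier L" "y \<in> carrier L" "z \<in> carrier L" "z \<sqsubseteq>\<^bsub>L\<^esub> x" "z \<sqsubseteq>\<^bsub>L\<^esub> y"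
    and "\<And>l. l \<in> carrier L \<Longrightarrow> l \<sqsubseteq>\<^bsub>L\<^esub> x \<Longrightarrow> l \<sqsubseteq>\<^bsub>L\<^esub> y \<Longrightarrow> l \<sqsubseteq>\<^bsub>L\<^esub> z"
    and "\<And>u v. u \<in> carrier L \<Longrightarrow> v \<in> carrier L \<Longrightarrow> u \<sqsubseteq>\<^bsub>L\<^esub> v \<Longrightarrow> v \<sqsubseteq>\<^bsub>L\<^esub> u \<Longrightarrow> u = v"
  shows "x \<sqinter>\<^bsub>L\<^esub> y = z"
proof -
  have Lower: "l \<in> Lower L {x, y} \<longleftrightarrow> l \<in> carrier L \<and> l \<sqsubseteq>\<^bsub>L\<^esub> x \<and> l \<sqsubseteq>\<^bsub>L\<^esub> y" for l
    using assms(1,2) unfolding Lower_def by auto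
  have "greatest L z (Lower L {x, y})"
    unfolding greatest_def
  proof (intro conjI ballI)
    show "Lower L {x, y} \<subseteq> carrier L" unfolding Lower_def by blast
    show "z \<in> Lower L {x, y}" unfolding Lower by (intro conjI assms(3-5))
    fix l assume "l \<in> Lower L {x, y}"
    then have "l \<in> carrier L" "l \<sqsubseteq>\<^bsub>L\<^esub> x" "l \<sqsubseteq>\<^bsub>L\<^esub> y" by (simp_all add: Lower)
    then show "l \<sqsubseteq>\<^bsub>L\<^esub> z" by (rule assms(6))
  qed
  moreover have "g = z" if g: "greatest L g (Lower L {x, y})" for g
  proof (rule assms(7))
    have "g \<in> Lower L {x, y}" using g by (simp only: greatest_def)
    then have "g \<in> carrier L" "g \<sqsubseteq>\<^bsub>L\<^esub> x" "g \<sqsubseteq>\<^bsub>L\<^esub> y" by (simp_all add: Lower)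
    then show "g \<in> carrier L" "g \<sqsubseteq>\<^bsub>L\<^esub> z" by (simp_all add: assms(6))
    have "z \<in> Lower L {x, y}" unfolding Lower by (intro conjI assms(3-5))
    then show "z \<sqsubseteq>\<^bsub>L\<^esub> g" using g unfolding greatest_def by blast
  qed (rule assms(3))
  ultimately have "greatest L g (Lower L {x, y}) \<longleftrightarrow> g = z" for g by blast
  then show ?thesis unfolding meet_def inf_def by simp
qed

theorem proposition38:
  fixes m n :: nat
  shows "shadow ` carrier (painted_tree_lattice m n) = carrier (shade_lattice m n) \<and>
    (\<forall>\<T>\<in>carrier (painted_tree_lattice m n). \<forall>\<T>'\<in>carrier (painted_tree_lattice m n).
       shadow (\<T> \<sqinter>\<^bsub>painted_tree_lattice m n\<^esub> \<T>') =
       shadow \<T> \<sqinter>\<^bsub>shade_lattice m n\<^esub> shadow \<T>')"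
proof (intro conjI ballI)
  let ?wf = "well_formed {1..m} n"
  let ?P = "painted_tree_lattice m n" and ?S = "shade_lattice m n"
  have P: "P \<in> carrier ?P \<longleftrightarrow> (\<exists>t w. ?wf t w \<and> P = encode t w)" for P
    by (simp add: painted_tree_lattice_def binary_painted_tree_iff)
  have S: "S \<in> carrier ?S \<longleftrightarrow> proper_shade {1..m} n S" for S
    by (simp add: shade_lattice_def unary_shade_iff)
  have le_P: "encode t w \<sqsubseteq>\<^bsub>?P\<^esub> encode t' w' \<longleftrightarrow> step\<^sup>*\<^sup>* (t, w) (t', w')" if "?wf t w" "?wf t' w'" for t w t' w'
  proof -
    have "t1 = t' \<and> w1 = w'" if "encode t' w' = encode t1 w1" "step\<^sup>*\<^sup>* (t, w) (t1, w1)" for t1 w1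
      using encode_inject[of t' t1 w' w1] steps_well_formed[OF that(2) \<open>?wf t w\<close>] \<open>?wf t' w'\<close> that(1)
      by (simp add: well_formed_def)
    then show ?thesis
      unfolding painted_tree_lattice_def using painted_rotations_iff[OF \<open>?wf t w\<close>, of "encode t' w'"] by auto
  qed
  have le_S: "U \<sqsubseteq>\<^bsub>?S\<^esub> V \<longleftrightarrow> (shade_rotation m n)\<^sup>*\<^sup>* U V" for U V by (simp add: shade_lattice_def)
  show "shadow ` carrier ?P = carrier ?S"
  proof (intro equalityI subsetI)
    fix U assume "U \<in> shadow ` carrier ?P"
    then show "U \<in> carrier ?S" using P S shadow_encode_wf proper_shade_of by auto
  next
    fix U assume U: "U \<in> carrier ?S"
    then have wf: "?wf (grow U) (lights U)" using S well_formed_grow by blast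
    have "shadow (encode (grow U) (lights U)) = U"
      using shadow_encode_wf[OF wf] grow_props(4)[of U] U S by (simp add: proper_shade_def)
    then show "U \<in> shadow ` carrier ?P" using P wf by (metis image_eqI)
  qed
  fix Q Q' assume "Q \<in> carrier ?P" "Q' \<in> carrier ?P"
  then obtain t1 w1 t2 w2 where wf1: "?wf t1 w1" "Q = encode t1 w1" and wf2: "?wf t2 w2" "Q' = encode t2 w2"
    using P by blast
  obtain t w where wf: "?wf t w" and lower: "step\<^sup>*\<^sup>* (t, w) (t1, w1)" "step\<^sup>*\<^sup>* (t, w) (t2, w2)"
    and greatest: "\<And>t' w'. ?wf t' w' \<Longrightarrow> step\<^sup>*\<^sup>* (t', w') (t1, w1) \<Longrightarrow> step\<^sup>*\<^sup>* (t', w') (t2, w2) \<Longrightarrow>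
      step\<^sup>*\<^sup>* (t', w') (t, w)"
    using state_meet[OF wf1(1) wf2(1)] by metis
  have "Q \<sqinter>\<^bsub>?P\<^esub> Q' = encode t w"
    unfolding wf1(2) wf2(2)
  proof (rule inf_eqI)
    show "encode t w \<sqsubseteq>\<^bsub>?P\<^esub> encode t1 w1" "encode t w \<sqsubseteq>\<^bsub>?P\<^esub> encode t2 w2"
      using le_P wf wf1(1) wf2(1) lower by blast+
  next
    fix l assume "l \<in> carrier ?P" "l \<sqsubseteq>\<^bsub>?P\<^esub> encode t1 w1" "l \<sqsubseteq>\<^bsub>?P\<^esub> encode t2 w2"
    then show "l \<sqsubseteq>\<^bsub>?P\<^esub> encode t w" using P le_P wf wf1(1) wf2(1) greatest by metis
  next
    fix u v assume "u \<in> carrier ?P" "v \<in> carrier ?P" "u \<sqsubseteq>\<^bsub>?P\<^esub> v" "v \<sqsubseteq>\<^bsub>?P\<^esub> u"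
    then show "u = v" using P le_P steps_antisym by metis
  qed (use P wf wf1(1) wf2(1) in blast)+
  \<comment> \<open>A shade below both shadows grows to a tree below both trees, hence below their
    meet; the adjunction turns this back into a relation between shades.\<close>
  moreover have "shade_of t1 w1 \<sqinter>\<^bsub>?S\<^esub> shade_of t2 w2 = shade_of t w"
  proof (rule inf_eqI)
    show "shade_of t w \<sqsubseteq>\<^bsub>?S\<^esub> shade_of t1 w1" "shade_of t w \<sqsubseteq>\<^bsub>?S\<^esub> shade_of t2 w2"
      unfolding le_S using shade_of_steps[OF wf] lower by blast+
  next
    fix U assume U: "U \<in> carrier ?S" "U \<sqsubseteq>\<^bsub>?S\<^esub> shade_of t1 w1" "U \<sqsubseteq>\<^bsub>?S\<^esub> shade_of t2 w2"
    then have proper: "proper_shade {1..m} n U" using S by blast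
    show "U \<sqsubseteq>\<^bsub>?S\<^esub> shade_of t w"
      using U(2,3) greatest[OF well_formed_grow[OF proper]]
      unfolding le_S shade_le_iff[OF proper wf1(1)] shade_le_iff[OF proper wf2(1)] shade_le_iff[OF proper wf]
      by blast
  next
    fix U V assume U: "U \<in> carrier ?S" "V \<in> carrier ?S" "U \<sqsubseteq>\<^bsub>?S\<^esub> V" "V \<sqsubseteq>\<^bsub>?S\<^esub> U"
    then have proper: "proper_shade {1..m} n U" "proper_shade {1..m} n V" using S by blast+
    \<comment> \<open>Antisymmetry is inherited from the trees, because the section given by
      \<open>grow\<close> and \<open>lights\<close> is monotone and injective.\<close>
    have "grow U = grow V \<and> lights U = lights V"
      by (rule steps_antisym[OF well_formed_grow[OF proper(1)]]) (use U le_S grow_steps in blast)+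
    then show "U = V" using grow_props(4) proper unfolding proper_shade_def by metis
  qed (use S proper_shade_of wf wf1(1) wf2(1) in blast)+
  ultimately show "shadow (Q \<sqinter>\<^bsub>?P\<^esub> Q') = shadow Q \<sqinter>\<^bsub>?S\<^esub> shadow Q'"
    using shadow_encode_wf[OF wf] shadow_encode_wf[OF wf1(1)] shadow_encode_wf[OF wf2(1)] wf1(2) wf2(2)
    by simp
qed

end
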